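(* Under the standing assumptions and setting of the context, let $\pi\in\Pi(\mu,\nu)$ be a $d_L$-cyclically monotone transference plan with $\int d_L\,d\pi<\infty$, and assume that for every Borel set $A$ with $\mu(A)>0$ the set $\{t>0:\mu(A_t)>0\}$ is uncountable. Then there exists a Borel map $T:X\to X$ with $T_\sharp\mu=\nu$ and $\int d_L(x,T(x))\,\mu(dx)=\int d_L\,d\pi$.
   Context: Standing assumptions: $(X,d)$ Polish; $d_L:X\times X\to[0,+\infty]$ a Borel ($d\times d$) distance, possibly $+\infty$-valued; $(X,d_L)$ geodesic and non-branching (for $r\ge0$, $d_L(x,y)=r/2$ implies $\{z:d_L(x,z)=r\}\cap\{z:d_L(y,z)=r/2\}$ has at most one point); $d_L$-geodesics are $d$-continuous and locally compact in $(X,d)$ (for each geodesic $\gamma$ and point $x$ on it, $\gamma^{-1}(\bar B_r(x))$ is compact for some $r>0$). Setting: $\mu,\nu$ Borel probabilities on $X$, $\Pi(\mu,\nu)$ couplings; $\pi$ is concentrated on a $\sigma$-compact $d_L$-cyclically monotone $\Gamma\subset\{d_L<\infty\}$ ($\sum_{i=0}^n d_L(x_i,y_i)\le\sum_{i=0}^n d_L(x_{i+1},y_i)$, $x_{n+1}=x_0$). $\Gamma'$: pairs $(x,y)$ with $I\ge0$, $(w_i,z_i)\in\Gamma$, $w_0=x$, $z_I=y$, $w_{I+1}:=w_0$, $\sum_{i=0}^I(d_L(w_{i+1},z_i)-d_L(w_i,z_i))=0$. $G:=\{(x,y):\exists(w,z)\in\Gamma',\ d_L(w,x)+d_L(x,y)+d_L(y,z)=d_L(w,z)\}$,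 $G(x):=\{y:(x,y)\in G\}$, $G^{-1}(x):=\{y:(y,x)\in G\}$, $R(x):=G(x)\cup G^{-1}(x)$; $\mathcal T:=P_1(G^{-1}\setminus\{x=y\})\cap P_1(G\setminus\{x=y\})$, $\mathcal T_e:=P_1(G^{-1}\setminus\{x=y\})\cup P_1(G\setminus\{x=y\})$. $f:\mathcal T\to\mathcal T$ is a $\mu$-measurable cross-section of $R$ on $\mathcal T$. Ray map: for $y\in f(\mathcal T)$, $g(y,t)$ is the point $x\in G(y)$ with $d_L(x,y)=t$ if $t\ge0$ and the point $x\in G^{-1}(y)$ with $d_L(x,y)=-t$ if $t<0$. For $A\subset\mathcal T_e$, $A_t:=\{g(y,s+t):g(y,s)\in A\}$. *)

theory Defs
  imports "HOL-Analysis.Analysis" "HOL-Probability.Probability"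
begin

text \<open>The Polish space (X,d) is a type of class polish_space with d = dist.
  The distance dL takes values in [0,+infinity] (type ennreal).\<close>

definition ext_distance :: "('a \<Rightarrow> 'a \<Rightarrow> ennreal) \<Rightarrow> bool" where
  "ext_distance dL \<longleftrightarrow>
     (\<forall>x y. dL x y = 0 \<longleftrightarrow> x = y) \<and>
     (\<forall>x y. dL x y = dL y x) \<and>
     (\<forall>x y z. dL x z \<le> dL x y + dL y z)"

definition dL_geodesic :: "('a \<Rightarrow> 'a \<Rightarrow> ennreal) \<Rightarrow> (real \<Rightarrow> 'a) \<Rightarrow> bool" where
  "dL_geodesic dL \<gamma> \<longleftrightarrow> dL (\<gamma> 0) (\<gamma> 1) < \<infinity> \<and>
     (\<forall>s\<in>{0..1}. \<forall>t\<in>{0..1}. dL (\<gamma> s) (\<gamma> t) = ennreal \<bar>t - s\<bar> * dL (\<gamma> 0) (\<gamma> 1))"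

definition geodesic_space :: "('a \<Rightarrow> 'a \<Rightarrow> ennreal) \<Rightarrow> bool" where
  "geodesic_space dL \<longleftrightarrow>
     (\<forall>x y. dL x y < \<infinity> \<longrightarrow> (\<exists>\<gamma>. dL_geodesic dL \<gamma> \<and> \<gamma> 0 = x \<and> \<gamma> 1 = y))"

definition non_branching :: "('a \<Rightarrow> 'a \<Rightarrow> ennreal) \<Rightarrow> bool" where
  "non_branching dL \<longleftrightarrow>
     (\<forall>x y (r::real) z1 z2. r \<ge> 0 \<longrightarrow> dL x y = ennreal (r/2) \<longrightarrow>
        dL x z1 = ennreal r \<longrightarrow> dL y z1 = ennreal (r/2) \<longrightarrow>
        dL x z2 = ennreal r \<longrightarrow> dL y z2 = ennreal (r/2) \<longrightarrow> z1 = z2)"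

definition geodesics_cont_loc_compact :: "('a::metric_space \<Rightarrow> 'a \<Rightarrow> ennreal) \<Rightarrow> bool" where
  "geodesics_cont_loc_compact dL \<longleftrightarrow>
     (\<forall>\<gamma>. dL_geodesic dL \<gamma> \<longrightarrow>
        continuous_on {0..1} \<gamma> \<and>
        (\<forall>x\<in>\<gamma> ` {0..1}. \<exists>r>0. compact ({0..1} \<inter> \<gamma> -` {z. dL x z \<le> ennreal r})))"

definition standing_assumptions :: "('a::polish_space \<Rightarrow> 'a \<Rightarrow> ennreal) \<Rightarrow> bool" where
  "standing_assumptions dL \<longleftrightarrow>
     ext_distance dL \<and>
     (\<lambda>p. dL (fst p) (snd p)) \<in> borel_measurable (borel \<Otimes>\<^sub>M borel) \<and>
     geodesic_space dL \<and> non_branching dL \<and> geodesics_cont_loc_compact dL"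

definition cyclically_monotone :: "('a \<Rightarrow> 'a \<Rightarrow> ennreal) \<Rightarrow> ('a \<times> 'a) set \<Rightarrow> bool" where
  "cyclically_monotone dL \<Gamma> \<longleftrightarrow>
     (\<forall>(n::nat) (x::nat \<Rightarrow> 'a) y. (\<forall>i\<le>n. (x i, y i) \<in> \<Gamma>) \<longrightarrow>
        (\<Sum>i\<le>n. dL (x i) (y i)) \<le> (\<Sum>i\<le>n. dL (x (if i = n then 0 else Suc i)) (y i)))"

definition sigma_compact :: "'b::topological_space set \<Rightarrow> bool" where
  "sigma_compact S \<longleftrightarrow> (\<exists>K::nat \<Rightarrow> 'b set. (\<forall>n. compact (K n)) \<and> S = (\<Union>n. K n))"

text \<open>Gamma': the condition sum (d(w_{i+1},z_i) - d(w_i,z_i)) = 0 is written as equality of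
  the two sums (equivalent since d(w_i,z_i) < infinity on Gamma).\<close>
definition Gamma' :: "('a \<Rightarrow> 'a \<Rightarrow> ennreal) \<Rightarrow> ('a \<times> 'a) set \<Rightarrow> ('a \<times> 'a) set" where
  "Gamma' dL \<Gamma> = {(x, y). \<exists>(I::nat) (w::nat \<Rightarrow> 'a) z.
      (\<forall>i\<le>I. (w i, z i) \<in> \<Gamma>) \<and> w 0 = x \<and> z I = y \<and>
      (\<Sum>i\<le>I. dL (w (if i = I then 0 else Suc i)) (z i)) = (\<Sum>i\<le>I. dL (w i) (z i))}"

definition Gset :: "('a \<Rightarrow> 'a \<Rightarrow> ennreal) \<Rightarrow> ('a \<times> 'a) set \<Rightarrow> ('a \<times> 'a) set" where
  "Gset dL \<Gamma> = {(x, y). \<exists>(w, z) \<in> Gamma' dL \<Gamma>. dL w x + dL x y + dL y z = dL w z}"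

definition Rrel :: "('a \<Rightarrow> 'a \<Rightarrow> ennreal) \<Rightarrow> ('a \<times> 'a) set \<Rightarrow> 'a \<Rightarrow> 'a set" where
  "Rrel dL \<Gamma> x = {y. (x, y) \<in> Gset dL \<Gamma>} \<union> {y. (y, x) \<in> Gset dL \<Gamma>}"

definition Tset :: "('a \<Rightarrow> 'a \<Rightarrow> ennreal) \<Rightarrow> ('a \<times> 'a) set \<Rightarrow> 'a set" where
  "Tset dL \<Gamma> = {x. \<exists>y. (y, x) \<in> Gset dL \<Gamma> \<and> x \<noteq> y} \<inter> {x. \<exists>y. (x, y) \<in> Gset dL \<Gamma> \<and> x \<noteq> y}"

definition Teset :: "('a \<Rightarrow> 'a \<Rightarrow> ennreal) \<Rightarrow> ('a \<times> 'a) set \<Rightarrow> 'a set" where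
  "Teset dL \<Gamma> = {x. \<exists>y. (y, x) \<in> Gset dL \<Gamma> \<and> x \<noteq> y} \<union> {x. \<exists>y. (x, y) \<in> Gset dL \<Gamma> \<and> x \<noteq> y}"

definition cross_section :: "('a \<Rightarrow> 'a set) \<Rightarrow> 'a set \<Rightarrow> ('a \<Rightarrow> 'a) \<Rightarrow> bool" where
  "cross_section R S f \<longleftrightarrow>
     (\<forall>x\<in>S. f x \<in> S \<and> f x \<in> R x \<and> (\<forall>y\<in>S. y \<in> R x \<longrightarrow> f y = f x))"

definition mu_measurable_on :: "'a::topological_space measure \<Rightarrow> 'a set \<Rightarrow> ('a \<Rightarrow> 'b::topological_space) \<Rightarrow> bool" where
  "mu_measurable_on \<mu> S f \<longleftrightarrow> (\<forall>B\<in>sets borel. f -` B \<inter> S \<in> sets (completion \<mu>))"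

text \<open>Ray map as a relation: ray_pt dL \<Gamma> y t x  iff  x = g(y,t) (the point is unique
  by non-branching).\<close>
definition ray_pt :: "('a \<Rightarrow> 'a \<Rightarrow> ennreal) \<Rightarrow> ('a \<times> 'a) set \<Rightarrow> 'a \<Rightarrow> real \<Rightarrow> 'a \<Rightarrow> bool" where
  "ray_pt dL \<Gamma> y t x \<longleftrightarrow>
     (t \<ge> 0 \<and> (y, x) \<in> Gset dL \<Gamma> \<and> dL x y = ennreal t) \<or>
     (t < 0 \<and> (x, y) \<in> Gset dL \<Gamma> \<and> dL x y = ennreal (- t))"

definition translate_set ::
  "('a \<Rightarrow> 'a \<Rightarrow> ennreal) \<Rightarrow> ('a \<times> 'a) set \<Rightarrow> ('a \<Rightarrow> 'a) \<Rightarrow> 'a set \<Rightarrow> real \<Rightarrow> 'a set" where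
  "translate_set dL \<Gamma> f A t =
     {x. \<exists>y\<in>f ` Tset dL \<Gamma>. \<exists>s a. ray_pt dL \<Gamma> y s a \<and> a \<in> A \<and> ray_pt dL \<Gamma> y (s + t) x}"

end

theory Submission
  imports Defs
begin

text \<open>
  Cyclical monotonicity makes G a partial order along which the distance is additive, and
  non-branching makes it linear on each ray through a point of T. Hence a point x of T is determined
  by its ray f(x) and its signed distance S(x) from f(x), and the target of a pair (x, y) is
  determined by f(x) and E = S(x) + d(x, y).

  A Borel set meeting every ray in at most one point has disjoint translates, so the hypothesis on
  translates makes it null: the law of S has no atoms along rays. Therefore S can be rearranged
  monotonically along each ray into a variable \<open>\<tau> \<ge> S\<close> such that \<open>(f, \<tau>)\<close> and \<open>(f, E)\<close> have the
  same law. Sending x to the point of its ray at position \<open>\<tau>\<close> has image measure \<open>\<nu>\<close>, and its cost is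
  unchanged because \<open>\<integral>(E - S) = \<integral>(P(S \<le> u) - P(E \<le> u)) du\<close> depends only on the laws of S and E. Points
  that the plan does not move are kept fixed.

  Neither G nor the ray map need be Borel. Measurability is obtained from inner regularity of the
  plan, which replaces images of Borel sets by countable unions of compact sets up to null sets.
\<close>

section \<open>Geometry of the transport rays\<close>

text \<open>The plan may split the mass of one source among several targets, and this has to be
  undone. On a single ray a plan is a coupling of two laws on the line with
  \<open>S \<le> E\<close>, and absence of atoms in the law of \<open>S\<close> allows a coupling
  carried by a graph. Two things could still go wrong. If \<tau> fell below \<open>S\<close>, the
  image would lie before its source and the distance would no longer be the difference of positions;
  \<open>S \<le> E\<close> prevents this, since it forces the quantiles of \<open>S\<close> below
  those of \<open>E\<close>. And position \<tau> might be empty, because a ray has ends; equality of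
  the laws puts (f, \<tau>) almost surely among the coordinates of actual targets, and such a target
  serves as the image. Linearity of a ray after or before a point rests on a proper predecessor or
  successor of that point, which is why the work takes place on T. The moved points outside T have
  no predecessor, so at most one of them precedes a given point of T, and the same null-set argument
  removes them.\<close>

locale transport_rays =
  fixes dL :: "'a \<Rightarrow> 'a \<Rightarrow> ennreal" and \<Gamma> :: "('a \<times> 'a) set"
  assumes dist: "ext_distance dL"
    and geod: "geodesic_space dL"
    and nonbranch: "non_branching dL"
    and mono: "cyclically_monotone dL \<Gamma>"
    and fin: "\<Gamma> \<subseteq> {(x, y). dL x y < \<infinity>}"
begin

abbreviation "G \<equiv> Gset dL \<Gamma>"
abbreviation "T \<equiv> Tset dL \<Gamma>"

lemma d_zero [simp]: "dL x y = 0 \<longleftrightarrow> x = y"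
  and d_commute: "dL x y = dL y x"
  and d_triangle: "dL x z \<le> dL x y + dL y z"
  using dist unfolding ext_distance_def by blast+

lemma d_self [simp]: "dL x x = 0"
  by simp

section \<open>Unique extension of segments\<close>

lemma geodesic_point:
  assumes "dL x y = ennreal r" "0 \<le> s" "s \<le> r"
  obtains u where "dL x u = ennreal s" "dL u y = ennreal (r - s)"
proof (cases "r = 0")
  case True
  then show ?thesis using assms that[of x] by simp
next
  case False
  have "dL x y < \<infinity>" using assms(1) by simp
  then obtain c where c: "dL_geodesic dL c" "c 0 = x" "c 1 = y"
    using geod unfolding geodesic_space_def by blast
  have eq: "dL (c s) (c t) = ennreal \<bar>t - s\<bar> * ennreal r" if "s \<in> {0..1}" "t \<in> {0..1}" for s t
    using c that assms(1) unfolding dL_geodesic_def by auto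
  have r: "0 < r" "0 \<le> s / r" "s / r \<le> 1" using False assms by auto
  have "dL x (c (s / r)) = ennreal s"
    using eq[of 0 "s / r"] r c(2) \<open>0 \<le> s\<close> by (simp add: ennreal_mult[symmetric])
  moreover have "dL (c (s / r)) y = ennreal (r - s)"
    using eq[of "s / r" 1] r c(3) by (simp add: ennreal_mult[symmetric] algebra_simps)
  ultimately show ?thesis using that by blast
qed

text \<open>\<open>non_branching\<close> speaks only of a segment extended by its own length. If
  \<open>b \<le> a\<close>, shortening the first piece to length \<open>b\<close> reduces to that
  case. If \<open>b > a\<close>, both extensions pass through the same point at distance
  \<open>a\<close> beyond \<open>x\<close>, and the argument restarts there with
  \<open>b - a\<close> in place of \<open>b\<close>; the Archimedean property bounds the number of
  restarts.\<close>

lemma non_branching_extension: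
  assumes "0 < a" "0 \<le> b" and "dL p x = ennreal a"
    and "dL x y = ennreal b" "dL p y = ennreal (a + b)"
    and "dL x z = ennreal b" "dL p z = ennreal (a + b)"
  shows "y = z"
proof -
  have midpoint: "y = z" if "0 \<le> r" "dL p x = ennreal r" "dL x y = ennreal r" "dL p y = ennreal (2 * r)"
    "dL x z = ennreal r" "dL p z = ennreal (2 * r)" for p x y z r
    using nonbranch[unfolded non_branching_def, rule_format, of "2 * r" p x y z] that by simp
  have "y = z" if "b \<le> real n * a" "0 \<le> b" "dL p x = ennreal a"
    "dL x y = ennreal b" "dL p y = ennreal (a + b)"
    "dL x z = ennreal b" "dL p z = ennreal (a + b)" for n p x y z b
    using that
  proof (induction n arbitrary: p x b)
    case 0
    then have "dL x y = 0" "dL x z = 0" by simp_all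
    then show ?case by simp
  next
    case (Suc n)
    \<comment> \<open>Reverse triangle inequality; the finite term \<open>t\<close> can be cancelled
      in \<open>ennreal\<close>.\<close>
    have tri: "ennreal s \<le> dL p' v"
      if "dL p v = ennreal (t + s)" "dL p p' = ennreal t" "0 \<le> t" "0 \<le> s" for p p' v s t
    proof -
      have "ennreal t + ennreal s \<le> ennreal t + dL p' v"
        using d_triangle[of p v p'] that by (simp add: ennreal_plus)
      then show ?thesis by (simp add: ennreal_add_left_cancel_le)
    qed
    show ?case
    proof (cases "b \<le> a")
      case True
      obtain p' where p': "dL p p' = ennreal (a - b)" "dL p' x = ennreal b"
        using geodesic_point[OF Suc.prems(3), of "a - b"] True \<open>0 < a\<close> \<open>0 \<le> b\<close> by auto
      have "dL p' v = ennreal (2 * b)" if "dL x v = ennreal b" "dL p v = ennreal (a + b)" for v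
      proof (rule antisym)
        show "dL p' v \<le> ennreal (2 * b)"
          using d_triangle[of p' v x] p' that \<open>0 \<le> b\<close> by (simp flip: ennreal_plus)
        show "ennreal (2 * b) \<le> dL p' v"
          using tri[of p v "a - b" "2 * b" p'] p' that True \<open>0 \<le> b\<close> by simp
      qed
      then show ?thesis
        using midpoint[of b p' x y z] p' Suc.prems by simp
    next
      case False
      obtain u where u: "dL x u = ennreal a" "dL u y = ennreal (b - a)"
        using geodesic_point[OF Suc.prems(4), of a] False \<open>0 < a\<close> by auto
      obtain v where v: "dL x v = ennreal a" "dL v z = ennreal (b - a)"
        using geodesic_point[OF Suc.prems(6), of a] False \<open>0 < a\<close> by auto
      \<comment> \<open>A distance below \<open>2 * a\<close> from \<open>p\<close> to
        \<open>w\<close> would make the whole way from \<open>p\<close> to \<open>e\<close> shorter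
        than \<open>a + b\<close>.\<close>
      have far: "dL p w = ennreal (2 * a)"
        if "dL x w = ennreal a" "dL w e = ennreal (b - a)" "dL p e = ennreal (a + b)" for w e
      proof (rule antisym)
        show "dL p w \<le> ennreal (2 * a)"
          using d_triangle[of p w x] that Suc.prems(3) \<open>0 < a\<close> by (simp flip: ennreal_plus)
        have "dL e p = ennreal ((b - a) + 2 * a)" using that by (simp add: d_commute)
        then show "ennreal (2 * a) \<le> dL p w"
          using tri[of e p "b - a" "2 * a" w] that False \<open>0 < a\<close> by (simp add: d_commute)
      qed
      have "u = v"
        using midpoint[of a p x u v] far[OF u Suc.prems(5)] far[OF v Suc.prems(7)] u v Suc.prems \<open>0 < a\<close>
        by simp
      then show ?thesis
        using Suc.IH[of "b - a" x u] False u v Suc.prems by (simp add: algebra_simps)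
    qed
  qed
  moreover obtain n where "b / a \<le> real n" using real_arch_simple by blast
  then have "b \<le> real n * a" using assms(1) by (simp add: field_simps)
  ultimately show ?thesis using assms by blast
qed

text \<open>Only the data for gluing are recorded: the free ends, the shifted cost \<open>C\<close>
  without its closing term, and the direct cost \<open>V\<close>. Leaving out the closing term
  \<open>dL x y\<close> makes concatenation additive, and both cyclical monotonicity and membership
  in \<open>Gamma'\<close> become a comparison of \<open>C + dL x y\<close> with
  \<open>V\<close>.\<close>

inductive chain :: "'a \<Rightarrow> 'a \<Rightarrow> ennreal \<Rightarrow> ennreal \<Rightarrow> bool" where
  single: "(x, y) \<in> \<Gamma> \<Longrightarrow> chain x y 0 (dL x y)"
| snoc: "chain x y C V \<Longrightarrow> (x', y') \<in> \<Gamma> \<Longrightarrow> chain x y' (C + dL x' y) (V + dL x' y')"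

lemma sum_cyclic:
  "(\<Sum>i\<le>I. dL (w (if i = I then 0 else Suc i)) (z i)) =
    (\<Sum>i<I. dL (w (Suc i)) (z i)) + dL (w (0::nat)) (z I)"
  by (simp add: lessThan_Suc_atMost[symmetric])

lemma chain_of_sequence:
  assumes "\<forall>i\<le>I. (w i, z i) \<in> \<Gamma>"
  shows "chain (w 0) (z I) (\<Sum>i<I. dL (w (Suc i)) (z i)) (\<Sum>i\<le>I. dL (w i) (z i))"
  using assms
proof (induction I)
  case 0
  then show ?case using single by simp
next
  case (Suc I)
  then show ?case
    using snoc[of "w 0" "z I" _ _ "w (Suc I)" "z (Suc I)"] by simp
qed

lemma sequence_of_chain:
  assumes "chain x y C V"
  shows "\<exists>I w z. (\<forall>i\<le>I. (w i, z i) \<in> \<Gamma>) \<and> w 0 = x \<and> z I = y \<and>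
    C = (\<Sum>i<I. dL (w (Suc i)) (z i)) \<and> V = (\<Sum>i\<le>I. dL (w i) (z i))"
  using assms
proof induction
  case (single x y)
  then show ?case
    by (intro exI[of _ 0] exI[of _ "\<lambda>_. x"] exI[of _ "\<lambda>_. y"]) simp
next
  case (snoc x y C V x' y')
  then obtain I w z where *: "\<forall>i\<le>I. (w i, z i) \<in> \<Gamma>" "w 0 = x" "z I = y"
    "C = (\<Sum>i<I. dL (w (Suc i)) (z i))" "V = (\<Sum>i\<le>I. dL (w i) (z i))"
    by blast
  let ?w = "w(Suc I := x')" and ?z = "z(Suc I := y')"
  have "(\<Sum>i<I. dL (?w (Suc i)) (?z i)) = C" "(\<Sum>i\<le>I. dL (?w i) (?z i)) = V"
    unfolding * by (auto intro!: sum.cong)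
  then show ?case using * snoc(2)
    by (intro exI[of _ "Suc I"] exI[of _ ?w] exI[of _ ?z]) (auto simp: le_Suc_eq)
qed

lemma Gamma'_iff: "(x, y) \<in> Gamma' dL \<Gamma> \<longleftrightarrow> (\<exists>C V. chain x y C V \<and> C + dL x y = V)"
proof
  assume "(x, y) \<in> Gamma' dL \<Gamma>"
  then obtain I w z where *: "\<forall>i\<le>I. (w i, z i) \<in> \<Gamma>" "w 0 = x" "z I = y"
    "(\<Sum>i<I. dL (w (Suc i)) (z i)) + dL (w 0) (z I) = (\<Sum>i\<le>I. dL (w i) (z i))"
    unfolding Gamma'_def sum_cyclic by blast
  then show "\<exists>C V. chain x y C V \<and> C + dL x y = V"
    using chain_of_sequence[OF *(1)] by metis
next
  assume "\<exists>C V. chain x y C V \<and> C + dL x y = V"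
  then obtain C V where "chain x y C V" "C + dL x y = V" by blast
  with sequence_of_chain[OF this(1)] show "(x, y) \<in> Gamma' dL \<Gamma>"
    unfolding Gamma'_def sum_cyclic by auto
qed

lemma chain_append:
  assumes "chain x' y' C' V'" "chain x y C V"
  shows "chain x y' (C + dL x' y + C') (V + V')"
  using assms(1)
proof induction
  case (single x' y')
  then show ?case using snoc[OF assms(2)] by simp
next
  case (snoc x' y' C' V' x'' y'')
  then show ?case using chain.snoc[OF snoc.IH snoc.hyps(2)] by (simp add: ac_simps)
qed

lemma chain_monotone:
  assumes "chain x y C V"
  shows "V \<le> C + dL x y"
proof -
  obtain I w z where *: "\<forall>i\<le>I. (w i, z i) \<in> \<Gamma>" "w 0 = x" "z I = y"
    "C = (\<Sum>i<I. dL (w (Suc i)) (z i))" "V = (\<Sum>i\<le>I. dL (w i) (z i))"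
    using sequence_of_chain[OF assms] by blast
  show ?thesis
    using mono[unfolded cyclically_monotone_def sum_cyclic] * by blast
qed

lemma chain_finite: "chain x y C V \<Longrightarrow> V < \<infinity>"
  by (induction rule: chain.induct) (use fin in auto)

lemma G_finite:
  assumes "(x, y) \<in> G"
  shows "dL x y < \<infinity>"
proof -
  obtain w z C V where "chain w z C V" "C + dL w z = V" "dL w x + dL x y + dL y z = dL w z"
    using assms unfolding Gset_def by (auto simp: Gamma'_iff)
  with chain_finite[OF this(1)] have "C + (dL w x + dL x y + dL y z) < \<top>" by simp
  then show ?thesis by simp
qed

text \<open>A point on an aligned path cuts it into aligned paths, the triangle inequalities being
  squeezed by the total length \<open>dL w z\<close>. Hence the witness \<open>(w, z)\<close> for
  \<open>(x, y)\<close> also serves both halves.\<close>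

lemma G_between:
  assumes "(x, y) \<in> G" "dL x u + dL u y = dL x y"
  shows "(x, u) \<in> G" "(u, y) \<in> G"
proof -
  obtain w z where wz: "(w, z) \<in> Gamma' dL \<Gamma>" "dL w x + dL x y + dL y z = dL w z"
    using assms(1) unfolding Gset_def by auto
  have sum: "dL w x + dL x u + (dL u y + dL y z) = dL w z"
    using wz(2) assms(2) by (metis add.assoc)
  have "dL w x + dL x u + dL u z = dL w z"
  proof (rule antisym)
    show "dL w x + dL x u + dL u z \<le> dL w z"
      using add_left_mono[OF d_triangle[of u z y]] sum by metis
    show "dL w z \<le> dL w x + dL x u + dL u z"
      using order.trans[OF d_triangle[of w z u] add_right_mono[OF d_triangle[of w u x]]] .
  qed
  moreover have "dL w u + dL u y + dL y z = dL w z"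
  proof (rule antisym)
    show "dL w u + dL u y + dL y z \<le> dL w z"
      using add_right_mono[OF d_triangle[of w u x], of "dL u y + dL y z"] sum by (metis add.assoc)
    show "dL w z \<le> dL w u + dL u y + dL y z"
      using order.trans[OF d_triangle[of w z u] add_left_mono[OF d_triangle[of u z y]]]
      by (simp add: add.assoc)
  qed
  ultimately show "(x, u) \<in> G" "(u, y) \<in> G"
    using wz(1) unfolding Gset_def by auto
qed

text \<open>Concatenating the chains of the two pairs and swapping their end points at the common
  point y can only lengthen the total, by monotonicity; the triangle inequality through y gives
  the converse bound.\<close>

lemma G_trans:
  assumes "(x, y) \<in> G" "(y, z) \<in> G"
  shows "(x, z) \<in> G" and G_add: "dL x z = dL x y + dL y z"
proof -
  obtain w1 z1 C1 V1 where 1: "chain w1 z1 C1 V1" "C1 + dL w1 z1 = V1"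
    "dL w1 x + dL x y + dL y z1 = dL w1 z1"
    using assms(1) unfolding Gset_def by (auto simp: Gamma'_iff)
  obtain w2 z2 C2 V2 where 2: "chain w2 z2 C2 V2" "C2 + dL w2 z2 = V2"
    "dL w2 y + dL y z + dL z z2 = dL w2 z2"
    using assms(2) unfolding Gset_def by (auto simp: Gamma'_iff)
  have ch: "chain w1 z2 (C1 + dL w2 z1 + C2) (V1 + V2)"
    using chain_append[OF 2(1) 1(1)] .
  have finC: "C1 + C2 < \<top>" and finV: "dL w1 z1 + dL w2 z2 < \<top>"
    using chain_finite[OF 1(1)] chain_finite[OF 2(1)] 1(2) 2(2) by auto
  have "(C1 + C2) + (dL w1 z1 + dL w2 z2) \<le> (C1 + C2) + (dL w2 z1 + dL w1 z2)"
    using chain_monotone[OF ch] unfolding 1(2)[symmetric] 2(2)[symmetric] by (simp only: ac_simps)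
  then have ge: "dL w1 z1 + dL w2 z2 \<le> dL w2 z1 + dL w1 z2"
    using finC unfolding ennreal_add_left_cancel_le by auto
  have w2z1: "dL w2 z1 \<le> dL w2 y + dL y z1" and w1y: "dL w1 y \<le> dL w1 x + dL x y"
    and yz2: "dL y z2 \<le> dL y z + dL z z2" and w1z2: "dL w1 z2 \<le> dL w1 x + dL x z + dL z z2"
    and xz: "dL x z \<le> dL x y + dL y z"
    using d_triangle order.trans[OF d_triangle[of w1 z2 z] add_right_mono[OF d_triangle[of w1 z x]]]
    by auto
  \<comment> \<open>The bracket \<open>dL w2 y + dL y z1\<close> is the way from \<open>w2\<close>
    to \<open>z1\<close> through \<open>y\<close>. It is split off because it bounds
    \<open>dL w2 z1\<close> and, being finite, can be cancelled.\<close>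
  have total: "dL w1 z1 + dL w2 z2 = (dL w2 y + dL y z1) + (dL w1 x + (dL x y + dL y z) + dL z z2)"
    unfolding 1(3)[symmetric] 2(3)[symmetric] by (simp only: ac_simps)
  have low: "(dL w2 y + dL y z1) + (dL w1 x + (dL x y + dL y z) + dL z z2) \<le>
      (dL w2 y + dL y z1) + dL w1 z2"
    using ge w2z1 total by (metis add_right_mono order.trans)
  have up: "(dL w2 y + dL y z1) + dL w1 z2 \<le> (dL w2 y + dL y z1) + (dL w1 x + dL x z + dL z z2)"
    using w1z2 by (rule add_left_mono)
  have fins: "dL w2 y + dL y z1 < \<top>" "dL w1 x < \<top>" "dL z z2 < \<top>"
    using finV unfolding total by simp_all
  have low': "dL w1 x + (dL x y + dL y z) + dL z z2 \<le> dL w1 z2"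
    using low fins(1) unfolding ennreal_add_left_cancel_le by auto
  have "dL w1 x + (dL x y + dL y z) + dL z z2 \<le> dL w1 x + dL x z + dL z z2"
    using low' w1z2 by (rule order.trans)
  then have "dL w1 x + (dL z z2 + (dL x y + dL y z)) \<le> dL w1 x + (dL z z2 + dL x z)"
    by (simp only: ac_simps)
  then have "dL x y + dL y z \<le> dL x z"
    using fins unfolding ennreal_add_left_cancel_le by auto
  with xz show eq: "dL x z = dL x y + dL y z" by simp
  \<comment> \<open>Equality now holds throughout, so \<open>w1\<close>, \<open>x\<close>,
    \<open>z\<close>, \<open>z2\<close> are aligned and the concatenated chain is tight:
    \<open>(w1, z2)\<close> is the witness for \<open>(x, z)\<close>.\<close>
  have w1z2': "dL w1 x + dL x z + dL z z2 = dL w1 z2"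
    using low' w1z2 eq by simp
  have "dL w2 z1 + dL w1 z2 \<le> dL w1 z1 + dL w2 z2"
    unfolding total using w2z1 w1z2 eq by (simp add: add_mono)
  with ge have sw: "dL w2 z1 + dL w1 z2 = dL w1 z1 + dL w2 z2" by simp
  have "C1 + dL w2 z1 + C2 + dL w1 z2 = V1 + V2"
    unfolding 1(2)[symmetric] 2(2)[symmetric]
    using arg_cong[OF sw, of "\<lambda>t. C1 + C2 + t"] by (simp only: ac_simps)
  with ch have "(w1, z2) \<in> Gamma' dL \<Gamma>" unfolding Gamma'_iff by blast
  with w1z2' show "(x, z) \<in> G" unfolding Gset_def by auto
qed

section \<open>The linear order along a ray\<close>

lemma \<Gamma>_subset_G: "\<Gamma> \<subseteq> G"
proof
  fix p assume "p \<in> \<Gamma>"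
  then obtain x y where p: "p = (x, y)" "(x, y) \<in> \<Gamma>" by (cases p) auto
  then have "(x, y) \<in> Gamma' dL \<Gamma>"
    using single[OF p(2)] unfolding Gamma'_iff by (metis add_0)
  then show "p \<in> G" unfolding p Gset_def by force
qed

lemma G_antisym: "(x, y) \<in> G \<Longrightarrow> (y, x) \<in> G \<Longrightarrow> x = y"
  using G_add[of x y x] by (metis add_eq_0_iff_both_eq_0 d_self d_zero)

lemma G_ennreal:
  assumes "(x, y) \<in> G"
  obtains r where "0 \<le> r" "dL x y = ennreal r"
  using G_finite[OF assms] by (cases "dL x y") auto

text \<open>A point of T has a proper predecessor, so non-branching applies to the rays leaving it.\<close>

lemma G_forward_linear:
  assumes "x \<in> T" "(x, y) \<in> G" "(x, z) \<in> G" "dL x y \<le> dL x z"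
  shows "(y, z) \<in> G"
proof -
  obtain p where p: "(p, x) \<in> G" "p \<noteq> x" using assms(1) unfolding Tset_def by blast
  obtain a where a: "0 \<le> a" "dL p x = ennreal a" using G_ennreal[OF p(1)] .
  obtain b where b: "0 \<le> b" "dL x y = ennreal b" using G_ennreal[OF assms(2)] .
  obtain c where c: "0 \<le> c" "dL x z = ennreal c" using G_ennreal[OF assms(3)] .
  have bc: "b \<le> c" using assms(4) b c by simp
  have "0 < a" using p a by (metis d_zero ennreal_0 less_eq_real_def)
  obtain u where u: "dL x u = ennreal b" "dL u z = ennreal (c - b)"
    using geodesic_point[OF c(2) b(1) bc] .
  have xuz: "dL x u + dL u z = dL x z" using u c b bc by (simp flip: ennreal_plus)
  note G = G_between[OF assms(3) xuz]
  \<comment> \<open>Both \<open>y\<close> and \<open>u\<close> extend the segment from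
    \<open>p\<close> to \<open>x\<close> by \<open>b\<close>, since distances add along
    \<open>G\<close>.\<close>
  have "y = u"
    using non_branching_extension[OF \<open>0 < a\<close> b(1) a(2) b(2) _ u(1)]
      G_add[OF p(1) assms(2)] G_add[OF p(1) G(1)] a b u by simp
  with G(2) show ?thesis by simp
qed

text \<open>The mirror image: a proper successor \<open>p\<close> of \<open>x\<close> provides the
  segment, and both \<open>y\<close> and \<open>u\<close> extend it backwards beyond
  \<open>x\<close> by \<open>b\<close>.\<close>

lemma G_backward_linear:
  assumes "x \<in> T" "(y, x) \<in> G" "(z, x) \<in> G" "dL y x \<le> dL z x"
  shows "(z, y) \<in> G"
proof -
  obtain p where p: "(x, p) \<in> G" "p \<noteq> x" using assms(1) unfolding Tset_def by blast
  obtain a where a: "0 \<le> a" "dL x p = ennreal a" using G_ennreal[OF p(1)] .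
  obtain b where b: "0 \<le> b" "dL y x = ennreal b" using G_ennreal[OF assms(2)] .
  obtain c where c: "0 \<le> c" "dL z x = ennreal c" using G_ennreal[OF assms(3)] .
  have bc: "b \<le> c" using assms(4) b c by simp
  have "0 < a" using p a by (metis d_zero ennreal_0 less_eq_real_def)
  obtain u where u: "dL z u = ennreal (c - b)" "dL u x = ennreal b"
    using geodesic_point[OF c(2), of "c - b"] b(1) bc by auto
  have zux: "dL z u + dL u x = dL z x" using u c b bc by (simp flip: ennreal_plus)
  note G = G_between[OF assms(3) zux]
  have "y = u"
    using non_branching_extension[OF \<open>0 < a\<close> b(1), of p x y u]
      G_add[OF assms(2) p(1)] G_add[OF G(2) p(1)] a b u by (simp add: d_commute add.commute)
  with G(1) show ?thesis by simp
qed

text \<open>Positions are signed, so the two points may lie on the same side of \<open>y\<close> or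
  on different sides. In the first case linearity gives the order and additivity the distance; in
  the second \<open>y\<close> lies between them and transitivity suffices.\<close>

lemma ray_pt_translate:
  assumes "y \<in> T" "ray_pt dL \<Gamma> y s a" "ray_pt dL \<Gamma> y (s + t) x" "0 < t"
  shows "(a, x) \<in> G" "dL a x = ennreal t"
proof -
  consider (pos) "0 \<le> s" | (mixed) "s < 0" "0 \<le> s + t" | (neg) "s + t < 0"
    using assms(4) by linarith
  then have "(a, x) \<in> G \<and> dL a x = ennreal t"
  proof cases
    case pos
    then have *: "(y, a) \<in> G" "dL y a = ennreal s" "(y, x) \<in> G" "dL y x = ennreal (s + t)"
      using assms unfolding ray_pt_def by (auto simp: d_commute)
    have ax: "(a, x) \<in> G" using G_forward_linear[OF assms(1) *(1,3)] * pos assms(4) by simp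
    have "ennreal s + dL a x = ennreal s + ennreal t"
      using G_add[OF *(1) ax] * pos assms(4) by simp
    with ax show ?thesis by simp
  next
    case mixed
    then have *: "(a, y) \<in> G" "dL a y = ennreal (- s)" "(y, x) \<in> G" "dL y x = ennreal (s + t)"
      using assms unfolding ray_pt_def by (auto simp: d_commute)
    show ?thesis
      using G_trans[OF *(1,3)] * mixed by (simp flip: ennreal_plus)
  next
    case neg
    then have *: "(a, y) \<in> G" "dL a y = ennreal (- s)" "(x, y) \<in> G" "dL x y = ennreal (- s - t)"
      using assms unfolding ray_pt_def by (auto simp: d_commute)
    have ax: "(a, x) \<in> G" using G_backward_linear[OF assms(1) *(3,1)] * neg assms(4) by simp
    have "ennreal (- s - t) + dL a x = ennreal (- s - t) + ennreal t"
      using G_add[OF ax *(3)] * neg assms(4) by (simp add: add.commute flip: ennreal_plus)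
    with ax show ?thesis by simp
  qed
  then show "(a, x) \<in> G" "dL a x = ennreal t" by auto
qed

end

section \<open>Signed positions on rays\<close>

locale ray_section = transport_rays +
  fixes f :: "'a \<Rightarrow> 'a"
  assumes cross: "cross_section (Rrel dL \<Gamma>) T f"
begin

lemma section_mem: "x \<in> T \<Longrightarrow> f x \<in> T"
  and section_related: "x \<in> T \<Longrightarrow> (x, f x) \<in> G \<or> (f x, x) \<in> G"
  and section_eq: "x \<in> T \<Longrightarrow> y \<in> T \<Longrightarrow> (x, y) \<in> G \<Longrightarrow> f x = f y"
  using cross unfolding cross_section_def Rrel_def by blast+

text \<open>The signed distance from the chosen point of the ray, nonnegative from that point
  onwards. Related points have finite distance, so on T the conversion by \<open>enn2real\<close>
  loses nothing.\<close>

definition pos :: "'a \<Rightarrow> real" where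
  "pos x = (if (f x, x) \<in> G then enn2real (dL (f x) x) else - enn2real (dL (f x) x))"

lemma pos_cases:
  assumes "x \<in> T"
  shows "((f x, x) \<in> G \<and> 0 \<le> pos x \<and> dL (f x) x = ennreal (pos x)) \<or>
    ((x, f x) \<in> G \<and> pos x < 0 \<and> dL x (f x) = ennreal (- pos x))"
proof (cases "(f x, x) \<in> G")
  case True
  then show ?thesis using G_finite[OF True] unfolding pos_def by simp
next
  case False
  then have xf: "(x, f x) \<in> G" using section_related[OF assms] by blast
  with False have "x \<noteq> f x" by metis
  then have "0 < enn2real (dL x (f x))"
    using G_finite[OF xf] by (simp add: enn2real_positive_iff zero_less_iff_neq_zero)
  with False xf show ?thesis using G_finite[OF xf] unfolding pos_def
    by (simp add: d_commute)
qed

lemma pos_ray: "x \<in> T \<Longrightarrow> ray_pt dL \<Gamma> (f x) (pos x) x"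
  using pos_cases[of x] unfolding ray_pt_def by (auto simp: d_commute)

lemma pos_less:
  assumes "x \<in> T" "x' \<in> T" "f x = f x'" "pos x < pos x'"
  shows "(x, x') \<in> G" "dL x x' = ennreal (pos x' - pos x)"
  using ray_pt_translate[OF section_mem[OF assms(1)] pos_ray[OF assms(1)], of "pos x' - pos x" x']
    pos_ray[OF assms(2)] assms(3,4) by simp_all

text \<open>Equal positions lie on the same side of \<open>f x\<close> at the same distance, so
  linearity puts each point before the other.\<close>

lemma pos_inj:
  assumes "x \<in> T" "x' \<in> T" "f x = f x'" "pos x = pos x'"
  shows "x = x'"
proof -
  note c = pos_cases[OF assms(1)] and c' = pos_cases[OF assms(2), folded assms(3,4)]
  show ?thesis
  proof (cases "0 \<le> pos x")
    case True
    then have "(f x, x) \<in> G" "(f x, x') \<in> G" "dL (f x) x = dL (f x) x'"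
      using c c' by auto
    then show ?thesis
      using G_forward_linear[OF section_mem[OF assms(1)], of x x']
        G_forward_linear[OF section_mem[OF assms(1)], of x' x] G_antisym by simp
  next
    case False
    then have "(x, f x) \<in> G" "(x', f x) \<in> G" "dL x (f x) = dL x' (f x)"
      using c c' by auto
    then show ?thesis
      using G_backward_linear[OF section_mem[OF assms(1)], of x x']
        G_backward_linear[OF section_mem[OF assms(1)], of x' x] G_antisym by simp
  qed
qed

text \<open>It replaces the source of a pair by another point of the same ray, as long as that point
  is not beyond the target position \<open>e\<close>. In this way a target of the plan can become
  the image of a different source.\<close>

lemma ray_distance:
  assumes "x \<in> T" "x' \<in> T" "f x = f x'" "(x', y') \<in> G"
    and e: "dL x' y' = ennreal (e - pos x')" "pos x' \<le> e" "pos x \<le> e"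
  shows "(x, y') \<in> G" "dL x y' = ennreal (e - pos x)"
proof -
  consider "pos x < pos x'" | "pos x = pos x'" | "pos x' < pos x" by linarith
  then have "(x, y') \<in> G \<and> dL x y' = ennreal (e - pos x)"
  proof cases
    case 1
    note xx' = pos_less[OF assms(1-3) 1]
    then show ?thesis
      using G_trans[OF xx'(1) assms(4)] e 1 by (simp flip: ennreal_plus)
  next
    case 2
    then have "x = x'" using pos_inj[OF assms(1-3)] by blast
    then show ?thesis using assms(4) e by simp
  next
    case 3
    note x'x = pos_less[OF assms(2,1) assms(3)[symmetric] 3]
    have xy': "(x, y') \<in> G"
      using G_forward_linear[OF assms(2) x'x(1) assms(4)] x'x(2) e by (simp add: ennreal_leI)
    have "ennreal (pos x - pos x') + dL x y' = ennreal (pos x - pos x') + ennreal (e - pos x)"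
      using G_add[OF x'x(1) xy'] x'x(2) e 3 by (simp flip: ennreal_plus)
    with xy' show ?thesis by simp
  qed
  then show "(x, y') \<in> G" "dL x y' = ennreal (e - pos x)" by auto
qed

lemma ray_end_unique:
  assumes "x \<in> T" "x' \<in> T" "f x = f x'" "(x, y) \<in> G" "(x', y') \<in> G"
    and "dL x y = ennreal (e - pos x)" "pos x \<le> e"
    and "dL x' y' = ennreal (e - pos x')" "pos x' \<le> e"
  shows "y = y'"
proof -
  note d = ray_distance[OF assms(1-3,5,8,9,7)]
  then show ?thesis
    using G_forward_linear[OF assms(1,4) d(1)] G_forward_linear[OF assms(1) d(1) assms(4)]
      assms(6) G_antisym by simp
qed

text \<open>The sign of the position is read off from distances alone, which makes it
  measurable although G need not be a Borel set.\<close>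

lemma pos_eq_distances:
  assumes "x \<in> T" "(x, y) \<in> G" "x \<noteq> y"
  shows "pos x = (if dL (f x) y = dL (f x) x + dL x y then enn2real (dL (f x) x)
    else - enn2real (dL (f x) x))"
proof (cases "(f x, x) \<in> G")
  case True
  then show ?thesis using G_add[OF True assms(2)] unfolding pos_def by simp
next
  case False
  then have xf: "(x, f x) \<in> G" using section_related[OF assms(1)] by blast
  obtain a where a: "0 \<le> a" "dL x y = ennreal a" using G_ennreal[OF assms(2)] .
  obtain b where b: "0 \<le> b" "dL x (f x) = ennreal b" using G_ennreal[OF xf] .
  have "x \<noteq> f x" using False xf by metis
  then have ab: "0 < a" "0 < b" using a b assms(3) by (metis d_zero ennreal_0 less_eq_real_def)+
  \<comment> \<open>Here \<open>x\<close> strictly precedes \<open>f x\<close>, so \<open>y\<close>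
    and \<open>f x\<close> are comparable points after \<open>x\<close>: their distance is the
    difference of \<open>a\<close> and \<open>b\<close>, not the sum.\<close>
  have "dL (f x) y \<noteq> dL (f x) x + dL x y"
  proof
    assume eq: "dL (f x) y = dL (f x) x + dL x y"
    then have eq': "dL (f x) y = ennreal (a + b)" "dL y (f x) = ennreal (a + b)"
      using a b by (simp_all add: d_commute add.commute)
    show False
    proof (cases "a \<le> b")
      case True
      then have "(y, f x) \<in> G" using G_forward_linear[OF assms(1,2) xf] a b by simp
      from G_add[OF assms(2) this] show False using eq' a b ab by (simp flip: ennreal_plus)
    next
      case False
      then have "(f x, y) \<in> G" using G_forward_linear[OF assms(1) xf assms(2)] a b by simp
      from G_add[OF xf this] show False using eq' a b ab by (simp flip: ennreal_plus)
    qed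
  qed
  with False show ?thesis unfolding pos_def by simp
qed

end

section \<open>Measure-theoretic tools\<close>

text \<open>The total mass leaves room for only finitely many disjoint sets of measure above
  \<open>1 / real (Suc n)\<close>. An uncountable family of disjoint translates will contradict
  this.\<close>

lemma (in finite_measure) countable_disjoint_positive:
  assumes disj: "disjoint_family_on D I" and meas: "\<And>i. i \<in> I \<Longrightarrow> D i \<in> sets M"
    and pos: "\<And>i. i \<in> I \<Longrightarrow> emeasure M (D i) > 0"
  shows "countable I"
proof -
  define J where "J n = {i \<in> I. 1 / real (Suc n) < measure M (D i)}" for n
  have "finite (J n)" for n
  proof -
    have "card F \<le> nat \<lceil>real (Suc n) * measure M (space M)\<rceil>" if F: "F \<subseteq> J n" "finite F" for F
    proof -
      have FI: "F \<subseteq> I" using F(1) unfolding J_def by auto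
      have "real (card F) / real (Suc n) = (\<Sum>i\<in>F. 1 / real (Suc n))" by simp
      also have "\<dots> \<le> (\<Sum>i\<in>F. measure M (D i))"
        using F(1) unfolding J_def by (intro sum_mono) (auto intro: less_imp_le)
      also have "\<dots> = measure M (\<Union>i\<in>F. D i)"
        using F(2) FI meas disjoint_family_on_mono[OF FI disj]
        by (intro finite_measure_finite_Union[symmetric]) auto
      also have "\<dots> \<le> measure M (space M)" by (rule bounded_measure)
      finally have "real (card F) \<le> real (Suc n) * measure M (space M)"
        by (simp add: field_simps)
      then show ?thesis by linarith
    qed
    then show ?thesis using finite_if_finite_subsets_card_bdd by blast
  qed
  moreover have "I = (\<Union>n. J n)"
  proof -
    have "\<exists>n. 1 / real (Suc n) < measure M (D i)" if "i \<in> I" for i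
    proof -
      have "0 < measure M (D i)" using pos[OF that] by (simp add: emeasure_eq_measure)
      then show ?thesis using reals_Archimedean by (simp add: inverse_eq_divide)
    qed
    then show ?thesis unfolding J_def by auto
  qed
  ultimately show ?thesis by (metis countable_UN countable_finite uncountable_def countableI_type)
qed

text \<open>Inner regularity gives the measure of \<open>D\<close> as a supremum over compact
  subsets, and a supremum in \<open>ennreal\<close> is approached along a sequence.\<close>

lemma inner_compact_exhaustion:
  fixes M :: "'a::{second_countable_topology, complete_space} measure"
  assumes "finite_measure M" and sets_M: "sets M = sets borel" and D: "D \<in> sets borel"
  obtains K :: "nat \<Rightarrow> 'a set" where "\<And>n. compact (K n)" "(\<Union>n. K n) \<subseteq> D"
    "emeasure M (D - (\<Union>n. K n)) = 0"
proof -
  interpret finite_measure M by fact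
  let ?A = "{K. K \<subseteq> D \<and> compact K}"
  have "?A \<noteq> {}" by auto
  from ennreal_SUP_countable_SUP[OF this, of "emeasure M"]
  obtain v :: "nat \<Rightarrow> ennreal" where v: "range v \<subseteq> emeasure M ` ?A" "Sup (emeasure M ` ?A) = (SUP n. v n)"
    by blast
  then have "\<forall>n. \<exists>K. K \<in> ?A \<and> v n = emeasure M K" by blast
  then obtain K where K: "\<And>n. K n \<subseteq> D" "\<And>n. compact (K n)" "\<And>n. v n = emeasure M (K n)"
    by (metis (mono_tags, lifting) mem_Collect_eq)
  have [measurable]: "K n \<in> sets M" for n
    using K(2) sets_M by (simp add: borel_compact)
  have DM: "D \<in> sets M" using D sets_M by simp
  have "emeasure M D = (SUP n. emeasure M (K n))"
    using inner_regular[OF sets_M _ D] v(2) K(3) by (simp add: emeasure_finite)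
  also have "\<dots> \<le> emeasure M (\<Union>n. K n)"
    by (intro SUP_least emeasure_mono) auto
  finally have "emeasure M D \<le> emeasure M (\<Union>n. K n)" .
  moreover have "emeasure M (D - (\<Union>n. K n)) = emeasure M D - emeasure M (\<Union>n. K n)"
    using K(1) DM by (intro emeasure_Diff) auto
  ultimately have "emeasure M (D - (\<Union>n. K n)) = 0"
    by (simp add: diff_eq_0_iff_ennreal emeasure_finite less_top[symmetric])
  then show ?thesis using that K by blast
qed

text \<open>A measure-theoretic substitute for the Lusin--Souslin theorem: applying inner regularity to
  the graph of \<open>(u, v)\<close> replaces images of Borel sets by projections of compact sets.\<close>

lemma factor_through:
  fixes M :: "'a::{second_countable_topology, complete_space} measure"
    and u :: "'a \<Rightarrow> 'b::{second_countable_topology, complete_space}"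
    and v :: "'a \<Rightarrow> 'c::{second_countable_topology, complete_space}"
  assumes "finite_measure M" and sets_M: "sets M = sets borel"
    and u[measurable]: "u \<in> borel_measurable borel" and v[measurable]: "v \<in> borel_measurable borel"
    and D[measurable]: "D \<in> sets borel"
    and det: "\<And>x y. x \<in> D \<Longrightarrow> y \<in> D \<Longrightarrow> u x = u y \<Longrightarrow> v x = v y"
  obtains D' h where "D' \<in> sets borel" "D' \<subseteq> D" "emeasure M (D - D') = 0" "u ` D' \<in> sets borel"
    "h \<in> borel_measurable borel" "\<And>x. x \<in> D' \<Longrightarrow> h (u x) = v x"
proof -
  interpret finite_measure M by fact
  have [measurable_cong]: "sets M = sets borel" by fact
  have space_M: "space M = UNIV" using sets_M sets_eq_imp_space_eq by fastforce
  define W where "W x = (x, u x, v x)" for x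
  have W[measurable]: "W \<in> borel_measurable borel"
    unfolding W_def borel_prod[symmetric] by measurable
  \<comment> \<open>\<open>u\<close> and \<open>v\<close> are only Borel, but on their graph they
    become continuous coordinate projections. Compact sets are therefore chosen inside the graph,
    for the image of \<open>M\<close> under \<open>W\<close>.\<close>
  define Gr where "Gr = {p. fst p \<in> D \<and> fst (snd p) = u (fst p) \<and> snd (snd p) = v (fst p)}"
  have Gr: "Gr \<in> sets borel"
  proof -
    have "{p \<in> space (borel \<Otimes>\<^sub>M (borel \<Otimes>\<^sub>M borel)). fst p \<in> D \<and> fst (snd p) = u (fst p) \<and> snd (snd p) = v (fst p)}
      \<in> sets (borel \<Otimes>\<^sub>M (borel \<Otimes>\<^sub>M borel))"
      by measurable
    then show ?thesis unfolding Gr_def borel_prod by simp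
  qed
  have [measurable]: "W \<in> M \<rightarrow>\<^sub>M borel" by simp
  interpret W: finite_measure "distr M borel W" by (rule finite_measure_distr) measurable
  obtain K where K: "\<And>n::nat. compact (K n)" "(\<Union>n. K n) \<subseteq> Gr"
    "emeasure (distr M borel W) (Gr - (\<Union>n. K n)) = 0"
    using inner_compact_exhaustion[OF W.finite_measure_axioms _ Gr] by auto
  have KB[measurable]: "(\<Union>n. K n) \<in> sets borel"
    using K(1) by (intro sets.countable_UN) (auto intro: borel_compact)
  define D' where "D' = W -` (\<Union>n. K n)"
  have D'D: "D' \<subseteq> D" using K(2) unfolding D'_def W_def Gr_def by auto
  have D': "D' \<in> sets borel"
    using measurable_sets[OF W KB] unfolding D'_def by simp
  have W_fst: "p = W (fst p)" if "p \<in> Gr" for p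
    using that unfolding Gr_def W_def by (cases p) auto
  have img: "w ` (D' \<inter> W -` C) = (\<lambda>p. w (fst p)) ` ((\<Union>n. K n) \<inter> C)" for w :: "'a \<Rightarrow> 'b" and C
  proof -
    have "D' \<inter> W -` C = fst ` ((\<Union>n. K n) \<inter> C)"
    proof (intro equalityI subsetI)
      fix x assume "x \<in> D' \<inter> W -` C"
      then have "W x \<in> (\<Union>n. K n) \<inter> C" unfolding D'_def by auto
      then show "x \<in> fst ` ((\<Union>n. K n) \<inter> C)" by (rule rev_image_eqI) (simp add: W_def)
    next
      fix x assume "x \<in> fst ` ((\<Union>n. K n) \<inter> C)"
      then obtain p where p: "p \<in> (\<Union>n. K n)" "p \<in> C" "x = fst p" by auto
      then have "W x = p" using K(2) W_fst by (metis subsetD)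
      with p show "x \<in> D' \<inter> W -` C" unfolding D'_def by auto
    qed
    then show ?thesis by (simp add: image_image)
  qed
  \<comment> \<open>Closedness of \<open>C\<close> keeps each piece compact, and on the graph
    \<open>u\<close> is a continuous coordinate, so the image is a countable union of compact
    sets.\<close>
  have imgB: "u ` (D' \<inter> W -` C) \<in> sets borel" if "closed C" for C
  proof -
    have "u ` (D' \<inter> W -` C) = (\<lambda>p. fst (snd p)) ` ((\<Union>n. K n) \<inter> C)"
      unfolding img
    proof (rule image_cong[OF refl])
      fix p assume "p \<in> (\<Union>n. K n) \<inter> C"
      then show "u (fst p) = fst (snd p)" using K(2) unfolding Gr_def by force
    qed
    also have "\<dots> = (\<Union>n. (\<lambda>p. fst (snd p)) ` (K n \<inter> C))" by auto
    also have "\<dots> \<in> sets borel"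
      using K(1) that
      by (intro sets.countable_UN) (auto intro!: borel_compact compact_continuous_image continuous_intros)
    finally show ?thesis .
  qed
  have uD': "u ` D' \<in> sets borel" using imgB[of UNIV] by simp
  define h where "h c = (if c \<in> u ` D' then v (SOME x. x \<in> D' \<and> u x = c) else undefined)" for c
  have h: "h (u x) = v x" if "x \<in> D'" for x
  proof -
    define y where "y = (SOME y. y \<in> D' \<and> u y = u x)"
    have "y \<in> D' \<and> u y = u x"
      unfolding y_def by (rule someI[of _ x]) (simp add: that)
    then have "v y = v x" using det[of y x] D'D that by auto
    then show ?thesis unfolding h_def y_def using that by simp
  qed
  have "h \<in> borel_measurable borel"
  proof (rule borel_measurableI)
    fix S :: "'c set" assume "open S"
    \<comment> \<open>Preimages of closed sets are computed, because \<open>imgB\<close> covers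
      closed conditions. The constant value of \<open>h\<close> elsewhere adds either nothing or the
      whole complement.\<close>
    define C where "C = - S"
    have C: "closed C" unfolding C_def using \<open>open S\<close> by (rule closed_Compl)
    have cl: "closed {p :: 'a \<times> 'b \<times> 'c. snd (snd p) \<in> C}"
      using closed_vimage[OF C, of "\<lambda>p. snd (snd p)"] by (simp add: vimage_def continuous_intros)
    have "h -` C = u ` (D' \<inter> W -` {p. snd (snd p) \<in> C}) \<union> (if undefined \<in> C then - u ` D' else {})"
    proof (intro equalityI subsetI)
      fix c assume c: "c \<in> h -` C"
      show "c \<in> u ` (D' \<inter> W -` {p. snd (snd p) \<in> C}) \<union> (if undefined \<in> C then - u ` D' else {})"
      proof (cases "c \<in> u ` D'")
        case True
        then obtain x where "x \<in> D'" "c = u x" by auto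
        with c h[of x] show ?thesis by (auto simp: W_def)
      next
        case False
        then show ?thesis using c unfolding h_def by simp
      qed
    next
      fix c assume "c \<in> u ` (D' \<inter> W -` {p. snd (snd p) \<in> C}) \<union> (if undefined \<in> C then - u ` D' else {})"
      then consider x where "x \<in> D'" "c = u x" "v x \<in> C" | "c \<notin> u ` D'" "undefined \<in> C"
        by (auto simp: W_def split: if_splits)
      then show "c \<in> h -` C"
      proof cases
        case 1
        then show ?thesis using h by simp
      next
        case 2
        then show ?thesis unfolding h_def by simp
      qed
    qed
    also have "\<dots> \<in> sets borel"
      using imgB[OF cl] uD' by (auto intro: borel_comp)
    finally have "- (h -` C) \<in> sets borel" by (rule borel_comp)
    then show "h -` S \<inter> space borel \<in> sets borel" unfolding C_def by (simp add: vimage_Compl)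
  qed
  moreover have "emeasure M (D - D') = 0"
  proof -
    have "W -` (Gr - (\<Union>n. K n)) \<inter> space M = D - D'"
      unfolding D'_def Gr_def by (auto simp: space_M W_def)
    moreover have "Gr - (\<Union>n. K n) \<in> sets borel" using Gr KB by auto
    ultimately show ?thesis using K(3) by (simp add: emeasure_distr)
  qed
  ultimately show ?thesis using that[OF D' D'D _ uD' _ h] by blast
qed

text \<open>Each preimage of a basic open set agrees with a Borel set off a null set; there are
  countably many of them, so one null set \<open>Z\<close> contains all exceptions.\<close>

lemma borel_version_on:
  fixes f :: "'a::topological_space \<Rightarrow> 'b::second_countable_topology"
  assumes sets_\<mu>: "sets \<mu> = sets borel" and f: "mu_measurable_on \<mu> S f"
  obtains S' f' where "S' \<in> sets borel" "S' \<subseteq> S" "S - S' \<in> null_sets (completion \<mu>)"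
    "f' \<in> borel_measurable borel" "\<And>x. x \<in> S' \<Longrightarrow> f' x = f x"
proof -
  obtain \<B> :: "'b set set" where \<B>: "countable \<B>" "topological_basis \<B>"
    using ex_countable_basis by blast
  \<comment> \<open>\<open>UNIV\<close> is added in order that \<open>S\<close> itself becomes Borel
    off \<open>Z\<close>.\<close>
  let ?C = "insert UNIV \<B>"
  have "\<exists>A N. A \<in> sets \<mu> \<and> N \<in> null_sets \<mu> \<and> (f -` b \<inter> S) - N = A - N" if "b \<in> ?C" for b
  proof -
    have "b \<in> sets borel" using that topological_basis_open[OF \<B>(2)] by auto
    then have "f -` b \<inter> S \<in> sets (completion \<mu>)" using f unfolding mu_measurable_on_def by blast
    then obtain A N N' where "f -` b \<inter> S = A \<union> N" "N \<subseteq> N'" "N' \<in> null_sets \<mu>" "A \<in> sets \<mu>"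
      by (rule sets_completionE)
    then show ?thesis by (intro exI[of _ A] exI[of _ N']) auto
  qed
  then obtain A N where AN: "\<And>b. b \<in> ?C \<Longrightarrow> A b \<in> sets \<mu> \<and> N b \<in> null_sets \<mu> \<and> (f -` b \<inter> S) - N b = A b - N b"
    by metis
  define Z where "Z = (\<Union>b\<in>?C. N b)"
  have Z: "Z \<in> null_sets \<mu>"
    unfolding Z_def using \<B>(1) AN by (intro null_sets_UN') auto
  have eq: "(f -` b \<inter> S) - Z = A b - Z" if "b \<in> ?C" for b
    using AN[OF that] that unfolding Z_def by blast
  have ZB: "Z \<in> sets borel" using Z sets_\<mu> by auto
  have B: "(f -` b \<inter> S) - Z \<in> sets borel" if "b \<in> ?C" for b
    unfolding eq[OF that] using AN[OF that] sets_\<mu> ZB by auto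
  have S': "S - Z \<in> sets borel" using B[of UNIV] by simp
  define f' where "f' x = (if x \<in> S - Z then f x else undefined)" for x
  have "f' \<in> borel_measurable borel"
  proof (rule borel_measurableI)
    fix U :: "'b set" assume "open U"
    then obtain \<C> where \<C>: "\<C> \<subseteq> \<B>" "U = \<Union>\<C>" using \<B>(2) unfolding topological_basis_def by metis
    have B': "(f -` b \<inter> S) - Z \<in> sets borel" if "b \<in> \<C>" for b
      using B[of b] \<C>(1) that by (simp add: subset_iff)
    have "countable \<C>" using \<C>(1) \<B>(1) by (rule countable_subset)
    then have 1: "(\<Union>b\<in>\<C>. (f -` b \<inter> S) - Z) \<in> sets borel"
      using B' by (rule sets.countable_UN'')
    have 2: "(if undefined \<in> U then - (S - Z) else {}) \<in> sets borel"
      using borel_comp[OF S'] by (cases "undefined \<in> U") (simp_all only: if_True if_False sets.empty_sets)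
    have 3: "f' -` U = (\<Union>b\<in>\<C>. (f -` b \<inter> S) - Z) \<union> (if undefined \<in> U then - (S - Z) else {})"
    proof (rule set_eqI)
      fix x
      show "x \<in> f' -` U \<longleftrightarrow> x \<in> (\<Union>b\<in>\<C>. (f -` b \<inter> S) - Z) \<union> (if undefined \<in> U then - (S - Z) else {})"
      proof (cases "x \<in> S - Z")
        case True
        then have "x \<in> f' -` U \<longleftrightarrow> (\<exists>b\<in>\<C>. f x \<in> b)" unfolding f'_def \<C>(2) by simp
        with True show ?thesis by simp
      next
        case False
        then have "f' x = undefined" unfolding f'_def by (rule if_not_P)
        with False show ?thesis by auto
      qed
    qed
    have "f' -` U \<in> sets borel"
      unfolding 3 by (rule sets.Un[OF 1 2])
    then show "f' -` U \<inter> space borel \<in> sets borel" by simp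
  qed
  moreover have "S - (S - Z) \<in> null_sets (completion \<mu>)"
    by (rule null_sets_completion_subset[OF _ null_sets_completionI[OF Z]]) auto
  ultimately show ?thesis using that[OF S'] unfolding f'_def by auto
qed

text \<open>The integrand is the length of \<open>{S x..<E x}\<close>, and Fubini turns the integral
  into one over levels \<open>u\<close> in which \<open>E\<close> enters only through its law.
  Subtracting masses level by level avoids the separate integrals of \<open>S\<close> and
  \<open>E\<close>, which may not exist.\<close>

lemma nn_integral_diff_cong_distr:
  fixes S E E' :: "'a \<Rightarrow> real"
  assumes "finite_measure N" and [measurable]: "S \<in> borel_measurable N" "E \<in> borel_measurable N" "E' \<in> borel_measurable N"
    and le: "\<And>x. S x \<le> E x" "\<And>x. S x \<le> E' x"
    and distr: "distr N borel E = distr N borel E'"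
  shows "(\<integral>\<^sup>+x. ennreal (E x - S x) \<partial>N) = (\<integral>\<^sup>+x. ennreal (E' x - S x) \<partial>N)"
proof -
  interpret finite_measure N by fact
  interpret P: pair_sigma_finite lborel N ..
  have slice: "(\<integral>\<^sup>+x. ennreal (F x - S x) \<partial>N) =
      (\<integral>\<^sup>+u. emeasure N {x \<in> space N. S x \<le> u} - emeasure (distr N borel F) {..u} \<partial>lborel)"
    if [measurable]: "F \<in> borel_measurable N" and le: "\<And>x. S x \<le> F x" for F
  proof -
    have "(\<integral>\<^sup>+x. ennreal (F x - S x) \<partial>N) = (\<integral>\<^sup>+x. (\<integral>\<^sup>+u. indicator {S x..<F x} u \<partial>lborel) \<partial>N)"
      using le by (intro nn_integral_cong) simp
    also have "\<dots> = (\<integral>\<^sup>+u. (\<integral>\<^sup>+x. indicator {S x..<F x} u \<partial>N) \<partial>lborel)"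
    proof (rule P.Fubini')
      have "(\<lambda>p. if S (snd p) \<le> fst p \<and> fst p < F (snd p) then 1 else 0 :: ennreal)
        \<in> borel_measurable (borel \<Otimes>\<^sub>M N)"
        by measurable
      also have "(\<lambda>p. if S (snd p) \<le> fst p \<and> fst p < F (snd p) then 1 else 0 :: ennreal) =
        (\<lambda>(u, x). indicator {S x..<F x} u)"
        by (auto simp: fun_eq_iff)
      finally show "(\<lambda>(u, x). indicator {S x..<F x} u :: ennreal) \<in> borel_measurable (lborel \<Otimes>\<^sub>M N)"
        by (simp cong: measurable_cong_sets)
    qed
    also have "\<dots> = (\<integral>\<^sup>+u. emeasure N {x \<in> space N. S x \<le> u} - emeasure (distr N borel F) {..u} \<partial>lborel)"
    proof (intro nn_integral_cong)
      fix u :: real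
      have "(\<integral>\<^sup>+x. indicator {S x..<F x} u \<partial>N) =
          (\<integral>\<^sup>+x. indicator ({x \<in> space N. S x \<le> u} - {x \<in> space N. F x \<le> u}) x \<partial>N)"
        by (intro nn_integral_cong) (auto simp: indicator_def)
      also have "\<dots> = emeasure N ({x \<in> space N. S x \<le> u} - {x \<in> space N. F x \<le> u})"
        by (intro nn_integral_indicator) measurable
      also have "\<dots> = emeasure N {x \<in> space N. S x \<le> u} - emeasure N {x \<in> space N. F x \<le> u}"
        using le by (intro emeasure_Diff) (auto intro: order.trans)
      also have "{x \<in> space N. F x \<le> u} = F -` {..u} \<inter> space N" by auto
      finally show "(\<integral>\<^sup>+x. indicator {S x..<F x} u \<partial>N) =
          emeasure N {x \<in> space N. S x \<le> u} - emeasure (distr N borel F) {..u}"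
        by (simp add: emeasure_distr)
    qed
    finally show ?thesis .
  qed
  show ?thesis using slice[of E] slice[of E'] le distr by simp
qed

section \<open>Rearrangement along the fibres\<close>

text \<open>\<open>q\<close> is the label of a fibre and \<open>S\<close> the position on it.
  Statements about almost every fibre are expressed by comparing masses over all Borel sets
  \<open>B\<close> of labels.\<close>

locale fibred_variable = finite_measure N for N :: "'w measure" +
  fixes q :: "'w \<Rightarrow> 'x::topological_space" and S :: "'w \<Rightarrow> real"
  assumes q [measurable]: "q \<in> borel_measurable N"
    and S [measurable]: "S \<in> borel_measurable N"
begin

lemma measure_split_base:
  assumes [measurable]: "B \<in> sets borel" "C \<in> sets borel" "Measurable.pred N P"
  shows "emeasure N {w \<in> space N. q w \<in> B \<and> P w} =
    emeasure N {w \<in> space N. q w \<in> B \<inter> C \<and> P w} + emeasure N {w \<in> space N. q w \<in> B - C \<and> P w}"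
proof -
  have "{w \<in> space N. q w \<in> B \<and> P w} =
      {w \<in> space N. q w \<in> B \<inter> C \<and> P w} \<union> {w \<in> space N. q w \<in> B - C \<and> P w}" by auto
  then show ?thesis by (simp only:) (intro plus_emeasure[symmetric], auto)
qed

text \<open>For finitely many thresholds the base is cut where the last one is the largest: there it
  alone decides, elsewhere it adds nothing. The bound for every \<open>B\<close> applies to both
  pieces, and continuity from below gives the countable case.\<close>

lemma thresholds_Sup_le:
  fixes g :: "nat \<Rightarrow> 'x \<Rightarrow> ereal"
  assumes g [measurable]: "\<And>i. g i \<in> borel_measurable borel" and Z [measurable]: "Measurable.pred N Z"
    and le: "\<And>i B. B \<in> sets borel \<Longrightarrow>
      emeasure N {w \<in> space N. q w \<in> B \<and> S w \<le> g i (q w)} \<le> emeasure N {w \<in> space N. q w \<in> B \<and> Z w}"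
    and B [measurable]: "B \<in> sets borel"
  shows "emeasure N {w \<in> space N. q w \<in> B \<and> (\<exists>i. S w \<le> g i (q w))} \<le> emeasure N {w \<in> space N. q w \<in> B \<and> Z w}"
proof -
  have fin: "emeasure N {w \<in> space N. q w \<in> B \<and> (\<exists>i<n. S w \<le> g i (q w))} \<le>
      emeasure N {w \<in> space N. q w \<in> B \<and> Z w}" if "B \<in> sets borel" for n B
    using that
  proof (induction n arbitrary: B)
    case 0
    then show ?case by simp
  next
    case (Suc n)
    note [measurable] = Suc.prems
    define C where "C = {x. \<forall>i<n. g i x \<le> g n x}"
    have "{x \<in> space borel. \<forall>i<n. g i x \<le> g n x} \<in> sets borel" by measurable
    then have C[measurable]: "C \<in> sets borel" unfolding C_def by simp
    have "{w \<in> space N. q w \<in> B \<inter> C \<and> (\<exists>i<Suc n. S w \<le> g i (q w))} =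
        {w \<in> space N. q w \<in> B \<inter> C \<and> S w \<le> g n (q w)}"
      unfolding C_def by (auto simp: less_Suc_eq intro: order.trans)
    moreover have "{w \<in> space N. q w \<in> B - C \<and> (\<exists>i<Suc n. S w \<le> g i (q w))} =
        {w \<in> space N. q w \<in> B - C \<and> (\<exists>i<n. S w \<le> g i (q w))}"
      unfolding C_def by (force simp: less_Suc_eq not_le)
    ultimately have "emeasure N {w \<in> space N. q w \<in> B \<and> (\<exists>i<Suc n. S w \<le> g i (q w))} =
        emeasure N {w \<in> space N. q w \<in> B \<inter> C \<and> S w \<le> g n (q w)} +
        emeasure N {w \<in> space N. q w \<in> B - C \<and> (\<exists>i<n. S w \<le> g i (q w))}"
      by (subst measure_split_base[of B C]) auto
    also have "\<dots> \<le> emeasure N {w \<in> space N. q w \<in> B \<inter> C \<and> Z w} + emeasure N {w \<in> space N. q w \<in> B - C \<and> Z w}"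
      by (intro add_mono le Suc.IH) auto
    also have "\<dots> = emeasure N {w \<in> space N. q w \<in> B \<and> Z w}"
      by (rule measure_split_base[symmetric]) auto
    finally show ?case .
  qed
  let ?U = "\<lambda>n. {w \<in> space N. q w \<in> B \<and> (\<exists>i<n. S w \<le> g i (q w))}"
  have "{w \<in> space N. q w \<in> B \<and> (\<exists>i. S w \<le> g i (q w))} = (\<Union>n. ?U n)" by auto
  also have "emeasure N \<dots> = (SUP n. emeasure N (?U n))"
  proof (rule SUP_emeasure_incseq[symmetric])
    show "range ?U \<subseteq> sets N" by auto
    show "incseq ?U" by (auto simp: incseq_def intro: less_le_trans)
  qed
  also have "\<dots> \<le> emeasure N {w \<in> space N. q w \<in> B \<and> Z w}"
    by (intro SUP_least fin B)
  finally show ?thesis .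
qed

text \<open>The dual statement; the passage to countably many thresholds is continuity from above
  and rests on finiteness of \<open>N\<close>.\<close>

lemma thresholds_Inf_ge:
  fixes h :: "nat \<Rightarrow> 'x \<Rightarrow> ereal"
  assumes h [measurable]: "\<And>i. h i \<in> borel_measurable borel" and Z [measurable]: "Measurable.pred N Z"
    and ge: "\<And>i B. B \<in> sets borel \<Longrightarrow>
      emeasure N {w \<in> space N. q w \<in> B \<and> Z w} \<le> emeasure N {w \<in> space N. q w \<in> B \<and> S w \<le> h i (q w)}"
    and B [measurable]: "B \<in> sets borel"
  shows "emeasure N {w \<in> space N. q w \<in> B \<and> Z w} \<le> emeasure N {w \<in> space N. q w \<in> B \<and> (\<forall>i. S w \<le> h i (q w))}"
proof -
  have fin: "emeasure N {w \<in> space N. q w \<in> B \<and> Z w} \<le>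
      emeasure N {w \<in> space N. q w \<in> B \<and> (\<forall>i<n. S w \<le> h i (q w))}" if "B \<in> sets borel" for n B
    using that
  proof (induction n arbitrary: B)
    case 0
    note [measurable] = 0
    show ?case by (intro emeasure_mono) auto
  next
    case (Suc n)
    note [measurable] = Suc.prems
    define C where "C = {x. \<forall>i<n. h n x \<le> h i x}"
    have "{x \<in> space borel. \<forall>i<n. h n x \<le> h i x} \<in> sets borel" by measurable
    then have C[measurable]: "C \<in> sets borel" unfolding C_def by simp
    have "{w \<in> space N. q w \<in> B \<inter> C \<and> (\<forall>i<Suc n. S w \<le> h i (q w))} =
        {w \<in> space N. q w \<in> B \<inter> C \<and> S w \<le> h n (q w)}"
      unfolding C_def by (auto simp: less_Suc_eq intro: order.trans)
    moreover have "{w \<in> space N. q w \<in> B - C \<and> (\<forall>i<Suc n. S w \<le> h i (q w))} =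
        {w \<in> space N. q w \<in> B - C \<and> (\<forall>i<n. S w \<le> h i (q w))}"
      unfolding C_def by (force simp: less_Suc_eq not_le)
    ultimately have eq: "emeasure N {w \<in> space N. q w \<in> B \<and> (\<forall>i<Suc n. S w \<le> h i (q w))} =
        emeasure N {w \<in> space N. q w \<in> B \<inter> C \<and> S w \<le> h n (q w)} +
        emeasure N {w \<in> space N. q w \<in> B - C \<and> (\<forall>i<n. S w \<le> h i (q w))}"
      by (subst measure_split_base[of B C]) auto
    have "emeasure N {w \<in> space N. q w \<in> B \<and> Z w} =
        emeasure N {w \<in> space N. q w \<in> B \<inter> C \<and> Z w} + emeasure N {w \<in> space N. q w \<in> B - C \<and> Z w}"
      by (rule measure_split_base) auto
    also have "\<dots> \<le> emeasure N {w \<in> space N. q w \<in> B \<inter> C \<and> S w \<le> h n (q w)} +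
        emeasure N {w \<in> space N. q w \<in> B - C \<and> (\<forall>i<n. S w \<le> h i (q w))}"
      by (intro add_mono ge Suc.IH) auto
    finally show ?case unfolding eq .
  qed
  let ?U = "\<lambda>n. {w \<in> space N. q w \<in> B \<and> (\<forall>i<n. S w \<le> h i (q w))}"
  have "emeasure N {w \<in> space N. q w \<in> B \<and> Z w} \<le> (INF n. emeasure N (?U n))"
    by (intro INF_greatest fin B)
  also have "\<dots> = emeasure N (\<Inter>n. ?U n)"
  proof (rule INF_emeasure_decseq)
    show "range ?U \<subseteq> sets N" by auto
    show "decseq ?U" by (auto simp: decseq_def intro: less_le_trans)
  qed (simp add: emeasure_finite)
  also have "(\<Inter>n. ?U n) = {w \<in> space N. q w \<in> B \<and> (\<forall>i. S w \<le> h i (q w))}" by auto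
  finally show ?thesis .
qed

text \<open>Restricting \<open>N\<close> to an event and projecting by \<open>q\<close> gives a
  finite measure on labels; the Hahn set of two such measures separates the labels where one event
  outweighs the other.\<close>

lemma base_Hahn_decomposition:
  assumes [measurable]: "Measurable.pred N Z1" "Measurable.pred N Z2"
  shows "\<exists>P. P \<in> sets borel \<and>
    (\<forall>B\<in>sets borel. B \<subseteq> P \<longrightarrow>
      emeasure N {w \<in> space N. q w \<in> B \<and> Z2 w} \<le> emeasure N {w \<in> space N. q w \<in> B \<and> Z1 w}) \<and>
    (\<forall>B\<in>sets borel. B \<inter> P = {} \<longrightarrow>
      emeasure N {w \<in> space N. q w \<in> B \<and> Z1 w} \<le> emeasure N {w \<in> space N. q w \<in> B \<and> Z2 w})"
proof -
  define L where "L Z = distr (density N (indicator {w \<in> space N. Z w})) borel q" for Z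
  have L: "emeasure (L Z) B = emeasure N {w \<in> space N. q w \<in> B \<and> Z w}"
    if [measurable]: "Measurable.pred N Z" "B \<in> sets borel" for Z B
  proof -
    have "emeasure (L Z) B = emeasure (density N (indicator {w \<in> space N. Z w})) (q -` B \<inter> space N)"
      unfolding L_def by (subst emeasure_distr) auto
    also have "\<dots> = emeasure N ({w \<in> space N. Z w} \<inter> (q -` B \<inter> space N))"
      by (intro emeasure_restricted) auto
    also have "{w \<in> space N. Z w} \<inter> (q -` B \<inter> space N) = {w \<in> space N. q w \<in> B \<and> Z w}" by auto
    finally show ?thesis .
  qed
  have fin: "finite_measure (L Z)" if "Measurable.pred N Z" for Z
  proof (rule finite_measureI)
    have "emeasure (L Z) (space (L Z)) = emeasure N {w \<in> space N. q w \<in> UNIV \<and> Z w}"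
      using L[OF that, of UNIV] by (simp add: L_def)
    then show "emeasure (L Z) (space (L Z)) \<noteq> \<infinity>" by (simp add: emeasure_finite)
  qed
  have sets_L: "sets (L Z) = sets borel" for Z unfolding L_def by simp
  have "sets (L Z2) = sets (L Z1)" by (simp only: sets_L)
  from finite_unsigned_Hahn_decomposition[OF fin[OF assms(1)] fin[OF assms(2)] this]
  obtain P where P: "P \<in> sets borel"
    "\<And>B. B \<in> sets borel \<Longrightarrow> B \<subseteq> P \<Longrightarrow> emeasure (L Z2) B \<le> emeasure (L Z1) B"
    "\<And>B. B \<in> sets borel \<Longrightarrow> B \<inter> P = {} \<Longrightarrow> emeasure (L Z1) B \<le> emeasure (L Z2) B"
    unfolding sets_L by blast
  show ?thesis
  proof (intro exI[of _ P] conjI ballI impI P(1))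
    fix B :: "'x set" assume B: "B \<in> sets borel" "B \<subseteq> P"
    show "emeasure N {w \<in> space N. q w \<in> B \<and> Z2 w} \<le> emeasure N {w \<in> space N. q w \<in> B \<and> Z1 w}"
      using P(2)[OF B] unfolding L[OF assms(1) B(1)] L[OF assms(2) B(1)] .
  next
    fix B :: "'x set" assume B: "B \<in> sets borel" "B \<inter> P = {}"
    show "emeasure N {w \<in> space N. q w \<in> B \<and> Z1 w} \<le> emeasure N {w \<in> space N. q w \<in> B \<and> Z2 w}"
      using P(3)[OF B] unfolding L[OF assms(1) B(1)] L[OF assms(2) B(1)] .
  qed
qed

end

locale diffuse_fibred_variable = fibred_variable N q S
  for N :: "'w measure" and q :: "'w \<Rightarrow> 'x::topological_space" and S +
  assumes diffuse: "\<And>\<sigma> :: 'x \<Rightarrow> ereal. \<sigma> \<in> borel_measurable borel \<Longrightarrow>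
    emeasure N {w \<in> space N. ereal (S w) = \<sigma> (q w)} = 0"
begin

text \<open>A fibrewise quantile: the threshold is the supremum of those rationals r below which the
  variable S carries, by Hahn decomposition, less mass than the event Z. No disintegration is
  needed.\<close>

lemma threshold_exists:
  assumes Z [measurable]: "Measurable.pred N Z"
  obtains \<sigma> :: "'x \<Rightarrow> ereal" where "\<sigma> \<in> borel_measurable borel"
    "\<And>B. B \<in> sets borel \<Longrightarrow>
      emeasure N {w \<in> space N. q w \<in> B \<and> S w \<le> \<sigma> (q w)} = emeasure N {w \<in> space N. q w \<in> B \<and> Z w}"
proof -
  define r :: "nat \<Rightarrow> real" where "r i = real_of_rat (from_nat i)" for i
  have r_dense: "\<exists>i. a < ereal (r i) \<and> ereal (r i) < b" if ab: "a < b" for a b :: ereal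
  proof -
    obtain c where c: "a < ereal c" "ereal c < b" using ereal_dense2[OF ab] by blast
    obtain d where d: "ereal c < ereal d" "ereal d < b" using ereal_dense2[OF c(2)] by blast
    then obtain p where "c < real_of_rat p" "real_of_rat p < d" using of_rat_dense[of c d] by auto
    moreover obtain i where "p = from_nat i" using surj_from_nat by (metis surjD)
    ultimately show ?thesis using c d unfolding r_def
      by (intro exI[of _ i]) (auto elim: order.strict_trans simp: less_ereal.simps(1)[symmetric] simp del: less_ereal.simps)
  qed
  have "\<exists>P. P \<in> sets borel \<and>
    (\<forall>B\<in>sets borel. B \<subseteq> P \<longrightarrow>
      emeasure N {w \<in> space N. q w \<in> B \<and> Z w} \<le> emeasure N {w \<in> space N. q w \<in> B \<and> S w \<le> r i}) \<and>
    (\<forall>B\<in>sets borel. B \<inter> P = {} \<longrightarrow>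
      emeasure N {w \<in> space N. q w \<in> B \<and> S w \<le> r i} \<le> emeasure N {w \<in> space N. q w \<in> B \<and> Z w})" for i
    by (rule base_Hahn_decomposition[OF _ Z]) measurable
  from choice[OF allI[OF this]] obtain P where P': "\<forall>i. P i \<in> sets borel \<and>
    (\<forall>B\<in>sets borel. B \<subseteq> P i \<longrightarrow>
      emeasure N {w \<in> space N. q w \<in> B \<and> Z w} \<le> emeasure N {w \<in> space N. q w \<in> B \<and> S w \<le> r i}) \<and>
    (\<forall>B\<in>sets borel. B \<inter> P i = {} \<longrightarrow>
      emeasure N {w \<in> space N. q w \<in> B \<and> S w \<le> r i} \<le> emeasure N {w \<in> space N. q w \<in> B \<and> Z w})"
    by (rule exE)
  have P [measurable]: "P i \<in> sets borel" for i
    using spec[OF P', of i] by (rule conjunct1)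
  note P_ge = P'[THEN spec, THEN conjunct2, THEN conjunct1, rule_format]
    and P_le = P'[THEN spec, THEN conjunct2, THEN conjunct2, rule_format]
  \<comment> \<open>Over \<open>P i\<close> the event \<open>S \<le> r i\<close> carries at least
    the mass of \<open>Z\<close>, so \<open>r i\<close> bounds the quantile from above; elsewhere it
    bounds it from below. \<open>g\<close> and \<open>h\<close> collect the lower and upper bounds,
    with infinite values where there is none.\<close>
  define g :: "nat \<Rightarrow> 'x \<Rightarrow> ereal" where "g i x = (if x \<in> P i then -\<infinity> else ereal (r i))" for i x
  define h :: "nat \<Rightarrow> 'x \<Rightarrow> ereal" where "h i x = (if x \<in> P i then ereal (r i) else \<infinity>)" for i x
  have g [measurable]: "g i \<in> borel_measurable borel" and h [measurable]: "h i \<in> borel_measurable borel" for i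
    unfolding g_def h_def by measurable
  define \<sigma> where "\<sigma> x = (SUP i. g i x)" for x
  have \<sigma> [measurable]: "\<sigma> \<in> borel_measurable borel" unfolding \<sigma>_def by measurable
  have "emeasure N {w \<in> space N. q w \<in> B \<and> S w \<le> \<sigma> (q w)} = emeasure N {w \<in> space N. q w \<in> B \<and> Z w}"
    if B [measurable]: "B \<in> sets borel" for B
  proof (rule antisym)
    \<comment> \<open>Strictly below the supremum some \<open>g i\<close> is already reached; the
      boundary case is the graph of \<sigma>, which is null by \<open>diffuse\<close>.\<close>
    have "emeasure N {w \<in> space N. q w \<in> B \<and> S w \<le> \<sigma> (q w)} \<le>
      emeasure N ({w \<in> space N. q w \<in> B \<and> (\<exists>i. S w \<le> g i (q w))} \<union> {w \<in> space N. ereal (S w) = \<sigma> (q w)})"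
    proof (rule emeasure_mono)
      show "{w \<in> space N. q w \<in> B \<and> S w \<le> \<sigma> (q w)} \<subseteq>
        {w \<in> space N. q w \<in> B \<and> (\<exists>i. S w \<le> g i (q w))} \<union> {w \<in> space N. ereal (S w) = \<sigma> (q w)}"
        unfolding \<sigma>_def by (auto simp: le_less less_SUP_iff)
    qed measurable
    also have "\<dots> \<le> emeasure N {w \<in> space N. q w \<in> B \<and> (\<exists>i. S w \<le> g i (q w))} +
        emeasure N {w \<in> space N. ereal (S w) = \<sigma> (q w)}"
      by (rule emeasure_subadditive) measurable
    also have "\<dots> = emeasure N {w \<in> space N. q w \<in> B \<and> (\<exists>i. S w \<le> g i (q w))}"
      using diffuse[OF \<sigma>] by simp
    also have "\<dots> \<le> emeasure N {w \<in> space N. q w \<in> B \<and> Z w}"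
    proof (rule thresholds_Sup_le[OF g Z _ B])
      fix i B assume [measurable]: "B \<in> sets (borel :: 'x measure)"
      have "emeasure N {w \<in> space N. q w \<in> B \<and> S w \<le> g i (q w)} =
          emeasure N {w \<in> space N. q w \<in> B - P i \<and> S w \<le> r i}"
        unfolding g_def by (rule arg_cong[where f="emeasure N"]) auto
      also have "\<dots> \<le> emeasure N {w \<in> space N. q w \<in> B - P i \<and> Z w}" by (rule P_le) auto
      also have "\<dots> \<le> emeasure N {w \<in> space N. q w \<in> B \<and> Z w}" by (rule emeasure_mono) auto
      finally show "emeasure N {w \<in> space N. q w \<in> B \<and> S w \<le> g i (q w)} \<le>
        emeasure N {w \<in> space N. q w \<in> B \<and> Z w}" .
    qed
    finally show "emeasure N {w \<in> space N. q w \<in> B \<and> S w \<le> \<sigma> (q w)} \<le> emeasure N {w \<in> space N. q w \<in> B \<and> Z w}" .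
    have "emeasure N {w \<in> space N. q w \<in> B \<and> Z w} \<le>
        emeasure N {w \<in> space N. q w \<in> B \<and> (\<forall>i. S w \<le> h i (q w))}"
    proof (rule thresholds_Inf_ge[OF h Z _ B])
      fix i B assume [measurable]: "B \<in> sets (borel :: 'x measure)"
      have "emeasure N {w \<in> space N. q w \<in> B \<and> Z w} =
          emeasure N {w \<in> space N. q w \<in> B \<inter> P i \<and> Z w} + emeasure N {w \<in> space N. q w \<in> B - P i \<and> Z w}"
        by (rule measure_split_base) auto
      also have "\<dots> \<le> emeasure N {w \<in> space N. q w \<in> B \<inter> P i \<and> S w \<le> r i} +
          emeasure N {w \<in> space N. q w \<in> B - P i \<and> S w \<le> h i (q w)}"
        unfolding h_def by (intro add_mono P_ge emeasure_mono) auto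
      also have "{w \<in> space N. q w \<in> B \<inter> P i \<and> S w \<le> r i} = {w \<in> space N. q w \<in> B \<inter> P i \<and> S w \<le> h i (q w)}"
        unfolding h_def by auto
      also have "emeasure N {w \<in> space N. q w \<in> B \<inter> P i \<and> S w \<le> h i (q w)} +
          emeasure N {w \<in> space N. q w \<in> B - P i \<and> S w \<le> h i (q w)} =
          emeasure N {w \<in> space N. q w \<in> B \<and> S w \<le> h i (q w)}"
        by (rule measure_split_base[symmetric]) auto
      finally show "emeasure N {w \<in> space N. q w \<in> B \<and> Z w} \<le>
        emeasure N {w \<in> space N. q w \<in> B \<and> S w \<le> h i (q w)}" .
    qed
    also have "\<dots> \<le> emeasure N {w \<in> space N. q w \<in> B \<and> S w \<le> \<sigma> (q w)}"
    proof (rule emeasure_mono)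
      \<comment> \<open>A rational strictly between \<sigma> and \<open>s\<close> would be either an
        upper bound below \<open>s\<close> or a lower bound above \<sigma>.\<close>
      have "s \<le> \<sigma> x" if s: "\<forall>i. s \<le> h i x" for s x
      proof (rule ccontr)
        assume "\<not> s \<le> \<sigma> x"
        then obtain i where i: "\<sigma> x < ereal (r i)" "ereal (r i) < s" using r_dense[of "\<sigma> x" s] by (auto simp: not_le)
        show False
        proof (cases "x \<in> P i")
          case True
          then show False using s[rule_format, of i] i(2) unfolding h_def by simp
        next
          case False
          then have "ereal (r i) \<le> \<sigma> x" unfolding \<sigma>_def g_def by (intro SUP_upper2[of i]) auto
          then show False using i(1) by simp
        qed
      qed
      then show "{w \<in> space N. q w \<in> B \<and> (\<forall>i. S w \<le> h i (q w))} \<subseteq> {w \<in> space N. q w \<in> B \<and> S w \<le> \<sigma> (q w)}"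
        by auto
    qed measurable
    finally show "emeasure N {w \<in> space N. q w \<in> B \<and> Z w} \<le> emeasure N {w \<in> space N. q w \<in> B \<and> S w \<le> \<sigma> (q w)}" .
  qed
  then show ?thesis using that \<sigma> by blast
qed

end

section \<open>Monotone rearrangement with prescribed law\<close>

lemma distr_Pair_eqI:
  fixes q :: "'w \<Rightarrow> 'x::topological_space" and a b :: "'w \<Rightarrow> real"
  assumes "finite_measure N"
    and [measurable]: "q \<in> borel_measurable N" "a \<in> borel_measurable N" "b \<in> borel_measurable N"
    and eq: "\<And>B e. B \<in> sets borel \<Longrightarrow>
      emeasure N {w \<in> space N. q w \<in> B \<and> a w < e} = emeasure N {w \<in> space N. q w \<in> B \<and> b w < e}"
  shows "distr N (borel \<Otimes>\<^sub>M borel) (\<lambda>w. (q w, a w)) = distr N (borel \<Otimes>\<^sub>M borel) (\<lambda>w. (q w, b w))"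
proof -
  interpret finite_measure N by fact
  have rect: "emeasure N {w \<in> space N. q w \<in> B \<and> a w \<in> C} = emeasure N {w \<in> space N. q w \<in> B \<and> b w \<in> C}"
    if B [measurable]: "B \<in> sets borel" and C: "C \<in> sets borel" for B C
  proof -
    define L where "L c = distr (density N (indicator {w \<in> space N. q w \<in> B})) borel c" for c :: "'w \<Rightarrow> real"
    have L: "emeasure (L c) A = emeasure N {w \<in> space N. q w \<in> B \<and> c w \<in> A}"
      if [measurable]: "c \<in> borel_measurable N" "A \<in> sets borel" for c A
    proof -
      have "emeasure (L c) A = emeasure (density N (indicator {w \<in> space N. q w \<in> B})) (c -` A \<inter> space N)"
        unfolding L_def by (subst emeasure_distr) auto
      also have "\<dots> = emeasure N ({w \<in> space N. q w \<in> B} \<inter> (c -` A \<inter> space N))"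
        by (intro emeasure_restricted) auto
      also have "{w \<in> space N. q w \<in> B} \<inter> (c -` A \<inter> space N) = {w \<in> space N. q w \<in> B \<and> c w \<in> A}" by auto
      finally show ?thesis .
    qed
    have "L a = L b"
    proof (rule measure_eqI_generator_eq[where E="range lessThan" and \<Omega>=UNIV and A="\<lambda>n::nat. {..<real n}"])
      show "Int_stable (range (lessThan :: real \<Rightarrow> real set))"
      proof (rule Int_stableI)
        fix X Y :: "real set" assume "X \<in> range lessThan" "Y \<in> range lessThan"
        then obtain x y where "X = {..<x}" "Y = {..<y}" by auto
        then have "X \<inter> Y = {..<min x y}" by auto
        then show "X \<inter> Y \<in> range lessThan" by simp
      qed
      fix X :: "real set" assume "X \<in> range lessThan"
      then obtain e where "X = {..<e}" by auto
      then show "emeasure (L a) X = emeasure (L b) X"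
        using eq[OF B, of e] by (simp add: L)
    next
      show "sets (L a) = sigma_sets UNIV (range lessThan)" "sets (L b) = sigma_sets UNIV (range lessThan)"
        unfolding L_def by (simp_all add: borel_Iio)
      show "(\<Union>n::nat. {..<real n}) = UNIV" by (auto intro: reals_Archimedean2)
      show "emeasure (L a) {..<real n} \<noteq> \<infinity>" for n by (simp add: L emeasure_finite)
    qed auto
    then show ?thesis using L[of a C] L[of b C] C by simp
  qed
  show ?thesis
  proof (rule measure_eqI_generator_eq[OF Int_stable_pair_measure_generator[of borel borel],
        where \<Omega>="UNIV \<times> UNIV" and A="\<lambda>_::nat. UNIV \<times> UNIV"])
    fix X :: "('x \<times> real) set" assume "X \<in> {A \<times> B |A B. A \<in> sets borel \<and> B \<in> sets borel}"
    then obtain B C where X: "X = B \<times> C" and [measurable]: "B \<in> sets borel" "C \<in> sets borel" by auto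
    have "(\<lambda>w. (q w, c w)) -` X \<inter> space N = {w \<in> space N. q w \<in> B \<and> c w \<in> C}" for c :: "'w \<Rightarrow> real"
      unfolding X by auto
    then show "emeasure (distr N (borel \<Otimes>\<^sub>M borel) (\<lambda>w. (q w, a w))) X =
        emeasure (distr N (borel \<Otimes>\<^sub>M borel) (\<lambda>w. (q w, b w))) X"
      using rect[of B C] by (simp add: emeasure_distr X)
  next
    show "range (\<lambda>_::nat. UNIV \<times> UNIV) \<subseteq> {A \<times> B |A B. A \<in> sets (borel :: 'x measure) \<and> B \<in> sets (borel :: real measure)}"
      by (rule image_subsetI, rule CollectI, intro exI conjI, rule refl) auto
    have "finite_measure (distr N (borel \<Otimes>\<^sub>M borel) (\<lambda>w. (q w, a w)))"
      by (rule finite_measure_distr) measurable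
    then show "emeasure (distr N (borel \<Otimes>\<^sub>M borel) (\<lambda>w. (q w, a w))) (UNIV \<times> UNIV) \<noteq> \<infinity>"
      by (simp add: finite_measure.emeasure_finite)
  qed (auto simp: sets_pair_measure)
qed

text \<open>Up to null sets, \<tau> is on each fibre the quantile function of \<open>E\<close>
  composed with the distribution function of \<open>S\<close>, built from rational levels: \<sigma>
  i marks where \<open>S\<close> has accumulated the mass of \<open>E \<le> r i\<close>, and \<tau>
  is the infimum of the levels whose mark has not been passed.\<close>

lemma (in diffuse_fibred_variable) fibrewise_rearrangement:
  fixes E :: "'w \<Rightarrow> real"
  assumes E [measurable]: "E \<in> borel_measurable N" and SE: "\<And>w. S w \<le> E w"
  obtains \<tau> where "\<tau> \<in> borel_measurable (borel \<Otimes>\<^sub>M borel)" "\<And>x s. s \<le> \<tau> (x, s)"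
    "distr N (borel \<Otimes>\<^sub>M borel) (\<lambda>w. (q w, \<tau> (q w, S w))) = distr N (borel \<Otimes>\<^sub>M borel) (\<lambda>w. (q w, E w))"
proof -
  define r :: "nat \<Rightarrow> real" where "r i = real_of_rat (from_nat i)" for i
  have r_dense: "\<exists>i. a < r i \<and> r i < b" if ab: "a < b" for a b :: real
  proof -
    obtain p where "a < real_of_rat p" "real_of_rat p < b" using of_rat_dense[OF ab] by auto
    moreover obtain i where "p = from_nat i" using surj_from_nat by (metis surjD)
    ultimately show ?thesis unfolding r_def by auto
  qed
  have "\<exists>\<sigma>. \<sigma> \<in> borel_measurable borel \<and> (\<forall>B\<in>sets borel.
      emeasure N {w \<in> space N. q w \<in> B \<and> S w \<le> (\<sigma> (q w) :: ereal)} = emeasure N {w \<in> space N. q w \<in> B \<and> E w \<le> r i})" for i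
    by (rule threshold_exists[of "\<lambda>w. E w \<le> r i"]) auto
  from choice[OF allI[OF this]] obtain \<sigma> :: "nat \<Rightarrow> 'x \<Rightarrow> ereal" where \<sigma>': "\<forall>i. \<sigma> i \<in> borel_measurable borel \<and> (\<forall>B\<in>sets borel.
      emeasure N {w \<in> space N. q w \<in> B \<and> S w \<le> \<sigma> i (q w)} = emeasure N {w \<in> space N. q w \<in> B \<and> E w \<le> r i})"
    by (rule exE)
  have \<sigma> [measurable]: "\<sigma> i \<in> borel_measurable borel" for i
    using spec[OF \<sigma>', of i] by (rule conjunct1)
  note \<sigma>_eq = \<sigma>'[THEN spec, THEN conjunct2, rule_format]
  \<comment> \<open>Capping at \<open>r i\<close> will give \<open>s \<le> \<tau> (x, s)\<close>
    everywhere. It loses no mass: where \<sigma> i exceeds \<open>r i\<close>, the event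
    \<open>E \<le> r i\<close> lies inside \<open>S \<le> r i\<close>, since
    \<open>S \<le> E\<close>.\<close>
  define \<rho> where "\<rho> i x = min (\<sigma> i x) (ereal (r i))" for i x
  have \<rho> [measurable]: "\<rho> i \<in> borel_measurable borel" for i unfolding \<rho>_def by measurable
  have \<rho>_eq: "emeasure N {w \<in> space N. q w \<in> B \<and> S w \<le> \<rho> i (q w)} = emeasure N {w \<in> space N. q w \<in> B \<and> E w \<le> r i}"
    if B [measurable]: "B \<in> sets borel" for B i
  proof -
    define C where "C = {x. \<sigma> i x \<le> ereal (r i)}"
    have "{x \<in> space borel. \<sigma> i x \<le> ereal (r i)} \<in> sets borel" by measurable
    then have C [measurable]: "C \<in> sets borel" unfolding C_def by simp
    have "{w \<in> space N. q w \<in> B \<inter> C \<and> S w \<le> \<rho> i (q w)} = {w \<in> space N. q w \<in> B \<inter> C \<and> S w \<le> \<sigma> i (q w)}"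
      unfolding C_def \<rho>_def by (auto simp: min_def)
    then have 1: "emeasure N {w \<in> space N. q w \<in> B \<inter> C \<and> S w \<le> \<rho> i (q w)} = emeasure N {w \<in> space N. q w \<in> B \<inter> C \<and> E w \<le> r i}"
      using \<sigma>_eq[of "B \<inter> C" i] by simp
    have 2: "emeasure N {w \<in> space N. q w \<in> B - C \<and> S w \<le> \<rho> i (q w)} = emeasure N {w \<in> space N. q w \<in> B - C \<and> E w \<le> r i}"
    proof (rule antisym)
      have "emeasure N {w \<in> space N. q w \<in> B - C \<and> S w \<le> \<rho> i (q w)} \<le> emeasure N {w \<in> space N. q w \<in> B - C \<and> S w \<le> \<sigma> i (q w)}"
        unfolding \<rho>_def by (intro emeasure_mono) auto
      then show "emeasure N {w \<in> space N. q w \<in> B - C \<and> S w \<le> \<rho> i (q w)} \<le> emeasure N {w \<in> space N. q w \<in> B - C \<and> E w \<le> r i}"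
        using \<sigma>_eq[of "B - C" i] by simp
      show "emeasure N {w \<in> space N. q w \<in> B - C \<and> E w \<le> r i} \<le> emeasure N {w \<in> space N. q w \<in> B - C \<and> S w \<le> \<rho> i (q w)}"
      proof (rule emeasure_mono)
        show "{w \<in> space N. q w \<in> B - C \<and> E w \<le> r i} \<subseteq> {w \<in> space N. q w \<in> B - C \<and> S w \<le> \<rho> i (q w)}"
        proof safe
          fix w assume w: "E w \<le> r i" "q w \<notin> C"
          have "S w \<le> r i" using SE[of w] w by simp
          then have "ereal (S w) \<le> ereal (r i)" by simp
          moreover have "ereal (r i) \<le> \<sigma> i (q w)" using w(2) unfolding C_def by simp
          ultimately show "ereal (S w) \<le> \<rho> i (q w)" unfolding \<rho>_def by (auto intro: order.trans)
        qed
      qed measurable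
    qed
    show ?thesis
      using measure_split_base[of B C "\<lambda>w. S w \<le> \<rho> i (q w)"] measure_split_base[of B C "\<lambda>w. E w \<le> r i"] 1 2
      by simp
  qed
  define t where "t p = (INF i. if ereal (snd p) \<le> \<rho> i (fst p) then ereal (r i) else \<infinity>)" for p
  have t [measurable]: "t \<in> borel_measurable (borel \<Otimes>\<^sub>M borel)" unfolding t_def by measurable
  have t_ge: "ereal s \<le> t (x, s)" for x s
    unfolding t_def by (rule INF_greatest) (auto simp: \<rho>_def)
  \<comment> \<open>Strict inequalities are used for the law, because a single level decides whether
    an infimum is strictly below \<open>e\<close>.\<close>
  have t_less: "t (x, s) < ereal e \<longleftrightarrow> (\<exists>i. ereal s \<le> \<rho> i x \<and> r i < e)" for x s e
    unfolding t_def INF_less_iff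
    by (auto simp only: fst_conv snd_conv UNIV_I simp_thms bex_UNIV split: if_splits) auto
  have t_law: "emeasure N {w \<in> space N. q w \<in> B \<and> t (q w, S w) < ereal e} = emeasure N {w \<in> space N. q w \<in> B \<and> E w < e}"
    if B [measurable]: "B \<in> sets borel" for B e
  proof (rule antisym)
    define g where "g i x = (if r i < e then \<rho> i x else -\<infinity>)" for i x
    have g [measurable]: "g i \<in> borel_measurable borel" for i unfolding g_def by measurable
    have "{w \<in> space N. q w \<in> B \<and> t (q w, S w) < ereal e} = {w \<in> space N. q w \<in> B \<and> (\<exists>i. ereal (S w) \<le> g i (q w))}"
      unfolding t_less g_def by (auto split: if_splits)
    also have "emeasure N \<dots> \<le> emeasure N {w \<in> space N. q w \<in> B \<and> E w < e}"
    proof (rule thresholds_Sup_le[OF g _ _ B])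
      fix i B assume [measurable]: "B \<in> sets (borel :: 'x measure)"
      show "emeasure N {w \<in> space N. q w \<in> B \<and> ereal (S w) \<le> g i (q w)} \<le> emeasure N {w \<in> space N. q w \<in> B \<and> E w < e}"
      proof (cases "r i < e")
        case True
        then have "emeasure N {w \<in> space N. q w \<in> B \<and> ereal (S w) \<le> g i (q w)} = emeasure N {w \<in> space N. q w \<in> B \<and> E w \<le> r i}"
          unfolding g_def using \<rho>_eq[of B i] by simp
        also have "\<dots> \<le> emeasure N {w \<in> space N. q w \<in> B \<and> E w < e}"
          using True by (intro emeasure_mono) auto
        finally show ?thesis .
      next
        case False
        then show ?thesis unfolding g_def by simp
      qed
    qed measurable
    finally show "emeasure N {w \<in> space N. q w \<in> B \<and> t (q w, S w) < ereal e} \<le> emeasure N {w \<in> space N. q w \<in> B \<and> E w < e}" .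
    \<comment> \<open>Masses are known at rational levels only, so \<open>E < e\<close> is exhausted
      by smaller closed half-lines, with a rational level between each of their bounds and
      \<open>e\<close>.\<close>
    let ?U = "\<lambda>n. {w \<in> space N. q w \<in> B \<and> E w \<le> e - inverse (real (Suc n))}"
    have "{w \<in> space N. q w \<in> B \<and> E w < e} = (\<Union>n. ?U n)"
    proof -
      have "(\<exists>n. x \<le> e - inverse (real (Suc n))) \<longleftrightarrow> x < e" for x
      proof
        assume "\<exists>n. x \<le> e - inverse (real (Suc n))"
        then obtain n where "x \<le> e - inverse (real (Suc n))" ..
        moreover have "0 < inverse (real (Suc n))" by simp
        ultimately show "x < e" by linarith
      next
        assume "x < e"
        then obtain n where "inverse (real (Suc n)) < e - x" using reals_Archimedean[of "e - x"] by auto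
        then show "\<exists>n. x \<le> e - inverse (real (Suc n))" by (intro exI[of _ n]) linarith
      qed
      then show ?thesis by blast
    qed
    also have "emeasure N \<dots> = (SUP n. emeasure N (?U n))"
    proof (rule SUP_emeasure_incseq[symmetric])
      show "range ?U \<subseteq> sets N" by auto
      show "incseq ?U"
      proof (rule incseq_SucI)
        fix n
        have "inverse (real (Suc (Suc n))) \<le> inverse (real (Suc n))" by (rule le_imp_inverse_le) auto
        then have "x \<le> e - inverse (real (Suc (Suc n)))" if "x \<le> e - inverse (real (Suc n))" for x
          using that by linarith
        then show "?U n \<subseteq> ?U (Suc n)" by blast
      qed
    qed
    also have "\<dots> \<le> emeasure N {w \<in> space N. q w \<in> B \<and> t (q w, S w) < ereal e}"
    proof (rule SUP_least)
      fix n
      have "e - inverse (real (Suc n)) < e" by simp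
      then obtain i where i: "e - inverse (real (Suc n)) < r i" "r i < e" using r_dense by blast
      have "emeasure N (?U n) \<le> emeasure N {w \<in> space N. q w \<in> B \<and> E w \<le> r i}"
        using i by (intro emeasure_mono) auto
      also have "\<dots> = emeasure N {w \<in> space N. q w \<in> B \<and> ereal (S w) \<le> \<rho> i (q w)}"
        using \<rho>_eq[OF B] by simp
      also have "\<dots> \<le> emeasure N {w \<in> space N. q w \<in> B \<and> t (q w, S w) < ereal e}"
        using i by (intro emeasure_mono) (auto simp: t_less)
      finally show "emeasure N (?U n) \<le> emeasure N {w \<in> space N. q w \<in> B \<and> t (q w, S w) < ereal e}" .
    qed
    finally show "emeasure N {w \<in> space N. q w \<in> B \<and> E w < e} \<le> emeasure N {w \<in> space N. q w \<in> B \<and> t (q w, S w) < ereal e}" .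
  qed
  \<comment> \<open>The events \<open>E < real n\<close> exhaust the space and have the masses of
    the corresponding events for \<open>t\<close>, so \<open>t\<close> is finite almost
    everywhere.\<close>
  have "emeasure N (space N) \<le> emeasure N {w \<in> space N. t (q w, S w) < \<infinity>}"
  proof -
    let ?U = "\<lambda>n::nat. {w \<in> space N. q w \<in> UNIV \<and> E w < real n}"
    have "space N = (\<Union>n. ?U n)" using reals_Archimedean2 by auto
    then have "emeasure N (space N) = emeasure N (\<Union>n. ?U n)" by (rule arg_cong)
    also have "\<dots> = (SUP n. emeasure N (?U n))"
      by (rule SUP_emeasure_incseq[symmetric]) (auto simp: incseq_def)
    also have "\<dots> \<le> emeasure N {w \<in> space N. t (q w, S w) < \<infinity>}"
    proof (rule SUP_least)
      fix n
      have "emeasure N (?U n) = emeasure N {w \<in> space N. q w \<in> UNIV \<and> t (q w, S w) < ereal (real n)}"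
        using t_law[of UNIV "real n"] by simp
      also have "\<dots> \<le> emeasure N {w \<in> space N. t (q w, S w) < \<infinity>}"
        by (intro emeasure_mono) (auto elim: less_trans)
      finally show "emeasure N (?U n) \<le> emeasure N {w \<in> space N. t (q w, S w) < \<infinity>}" .
    qed
    finally show ?thesis .
  qed
  then have "emeasure N {w \<in> space N. t (q w, S w) < \<infinity>} = emeasure N (space N)"
    by (intro antisym emeasure_space)
  then have null: "emeasure N (space N - {w \<in> space N. t (q w, S w) < \<infinity>}) = 0"
    by (subst emeasure_compl) (auto simp: emeasure_finite)
  have t_fin: "AE w in N. t (q w, S w) < \<infinity>"
    by (rule AE_I[OF _ null]) auto
  \<comment> \<open>Where \<open>t\<close> is infinite, \<open>real_of_ereal\<close> gives 0, and
    the maximum preserves the inequality there; where \<open>t\<close> is finite it changes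
    nothing.\<close>
  define \<tau> where "\<tau> p = max (snd p) (real_of_ereal (t p))" for p
  have \<tau> [measurable]: "\<tau> \<in> borel_measurable (borel \<Otimes>\<^sub>M borel)" unfolding \<tau>_def by measurable
  have \<tau>_t: "ereal (\<tau> (x, s)) = t (x, s)" if "t (x, s) < \<infinity>" for x s
    using t_ge[of s x] that unfolding \<tau>_def by (cases "t (x, s)") auto
  have "distr N (borel \<Otimes>\<^sub>M borel) (\<lambda>w. (q w, \<tau> (q w, S w))) = distr N (borel \<Otimes>\<^sub>M borel) (\<lambda>w. (q w, E w))"
  proof (rule distr_Pair_eqI[OF finite_measure_axioms])
    fix B e assume [measurable]: "B \<in> sets (borel :: 'x measure)"
    have "emeasure N {w \<in> space N. q w \<in> B \<and> \<tau> (q w, S w) < e} = emeasure N {w \<in> space N. q w \<in> B \<and> t (q w, S w) < ereal e}"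
    proof (rule emeasure_eq_AE)
      show "AE w in N. w \<in> {w \<in> space N. q w \<in> B \<and> \<tau> (q w, S w) < e} \<longleftrightarrow>
          w \<in> {w \<in> space N. q w \<in> B \<and> t (q w, S w) < ereal e}"
        using t_fin by eventually_elim (simp flip: \<tau>_t)
    qed measurable
    then show "emeasure N {w \<in> space N. q w \<in> B \<and> \<tau> (q w, S w) < e} = emeasure N {w \<in> space N. q w \<in> B \<and> E w < e}"
      using t_law[of B e] by simp
  qed measurable
  then show ?thesis using that[OF \<tau>] unfolding \<tau>_def by simp
qed

section \<open>Null sets of ray sections\<close>

locale ray_measure = ray_section dL \<Gamma> f
  for dL :: "'a::polish_space \<Rightarrow> 'a \<Rightarrow> ennreal" and \<Gamma> f +
  fixes \<mu> :: "'a measure"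
  assumes sets_\<mu>: "sets \<mu> = sets borel" and finite_\<mu>: "finite_measure \<mu>"
    and T_sets: "T \<in> sets (completion \<mu>)"
    and translates: "\<And>A. A \<in> sets borel \<Longrightarrow> A \<subseteq> Teset dL \<Gamma> \<Longrightarrow> emeasure \<mu> A > 0 \<Longrightarrow>
      uncountable {t::real. t > 0 \<and> emeasure (completion \<mu>) (translate_set dL \<Gamma> f A t) > 0}"
begin

lemma translate_setE:
  assumes "x \<in> translate_set dL \<Gamma> f A t" "0 < t"
  obtains a where "a \<in> A" "(a, x) \<in> G" "dL a x = ennreal t" "a \<noteq> x"
proof -
  obtain y s a where y: "y \<in> f ` T" and ray: "ray_pt dL \<Gamma> y s a" "ray_pt dL \<Gamma> y (s + t) x" and a: "a \<in> A"
    using assms(1) unfolding translate_set_def by blast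
  have "y \<in> T" using y section_mem by blast
  note ax = ray_pt_translate[OF this ray assms(2)]
  moreover have "a \<noteq> x"
  proof
    assume "a = x"
    then have "ennreal t = 0" using ax(2) by simp
    then show False using assms(2) by simp
  qed
  ultimately show ?thesis using that a by blast
qed

text \<open>Nothing lies after such a point, so every translate by \<open>t > 0\<close> is
  empty.\<close>

lemma terminal_points_null:
  assumes "C \<in> sets borel" "C \<subseteq> Teset dL \<Gamma>" and last: "\<And>c x. c \<in> C \<Longrightarrow> (c, x) \<in> G \<Longrightarrow> x = c"
  shows "emeasure \<mu> C = 0"
proof (rule ccontr)
  assume "emeasure \<mu> C \<noteq> 0"
  then have "uncountable {t::real. t > 0 \<and> emeasure (completion \<mu>) (translate_set dL \<Gamma> f C t) > 0}"
    using translates[OF assms(1,2)] by (simp add: zero_less_iff_neq_zero)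
  moreover have "translate_set dL \<Gamma> f C t = {}" if "0 < t" for t
    using last that by (metis all_not_in_conv translate_setE)
  then have "{t::real. t > 0 \<and> emeasure (completion \<mu>) (translate_set dL \<Gamma> f C t) > 0} = {}" by auto
  ultimately show False by simp
qed

text \<open>If a point of T lay in the translates by \<open>t\<close> and \<open>t'\<close>, its one
  predecessor in \<open>A\<close> would be at both distances from it. So the translates are disjoint
  within T, and uncountably many have positive measure.\<close>

lemma partial_section_null:
  assumes "A \<in> sets borel" "A \<subseteq> Teset dL \<Gamma>"
    and unique: "\<And>x a a'. x \<in> T \<Longrightarrow> a \<in> A \<Longrightarrow> a' \<in> A \<Longrightarrow> (a, x) \<in> G \<Longrightarrow> (a', x) \<in> G \<Longrightarrow> a = a'"
  shows "emeasure \<mu> A = 0"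
proof (rule ccontr)
  assume "emeasure \<mu> A \<noteq> 0"
  define I where "I = {t::real. t > 0 \<and> emeasure (completion \<mu>) (translate_set dL \<Gamma> f A t) > 0}"
  have unc: "uncountable I"
    unfolding I_def using translates[OF assms(1,2)] \<open>emeasure \<mu> A \<noteq> 0\<close> by (simp add: zero_less_iff_neq_zero)
  \<comment> \<open>Uniqueness of the predecessor is available at points of T only. A translated
    point outside T has a predecessor, hence no proper successor, so what is cut off is
    null.\<close>
  define D where "D t = translate_set dL \<Gamma> f A t \<inter> T" for t
  interpret \<mu>: finite_measure \<mu> by (rule finite_\<mu>)
  interpret c: finite_measure "completion \<mu>"
    by (rule finite_measureI) simp
  \<comment> \<open>\<open>emeasure\<close> is 0 outside the sigma-algebra, so positivity yields
    measurability.\<close>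
  have At: "translate_set dL \<Gamma> f A t \<in> sets (completion \<mu>)" if "t \<in> I" for t
    using that emeasure_notin_sets unfolding I_def by force
  have D: "D t \<in> sets (completion \<mu>)" if "t \<in> I" for t
    using At[OF that] T_sets unfolding D_def by auto
  have "emeasure (completion \<mu>) (D t) > 0" if t: "t \<in> I" for t
  proof -
    let ?A = "translate_set dL \<Gamma> f A t"
    have "0 < t" using t unfolding I_def by simp
    \<comment> \<open>A Borel subset of the cut-off part with the same measure, since the hypothesis
      on translates concerns Borel sets.\<close>
    define C where "C = main_part \<mu> (?A - T)"
    have diff: "?A - T \<in> sets (completion \<mu>)" using At[OF t] T_sets by auto
    have sub: "C \<subseteq> ?A - T"
      unfolding C_def using main_part_null_part_Un[OF diff] by blast
    have pred: "\<exists>a. (a, x) \<in> G \<and> a \<noteq> x" if "x \<in> C" for x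
      using sub that translate_setE[OF _ \<open>0 < t\<close>] by (metis DiffD1 subsetD)
    have "emeasure \<mu> C = 0"
    proof (rule terminal_points_null)
      show "C \<in> sets borel" unfolding C_def using main_part_sets[OF diff] sets_\<mu> by simp
      show "C \<subseteq> Teset dL \<Gamma>" using pred unfolding Teset_def by blast
      fix c x assume "c \<in> C" "(c, x) \<in> G"
      then show "x = c" using pred[of c] sub unfolding Tset_def by blast
    qed
    then have "emeasure (completion \<mu>) (?A - T) = 0"
      unfolding C_def using emeasure_completion[OF diff] by simp
    moreover have "emeasure (completion \<mu>) ?A = emeasure (completion \<mu>) (D t) + emeasure (completion \<mu>) (?A - T)"
    proof -
      have "?A = D t \<union> (?A - T)" unfolding D_def by blast
      moreover have "D t \<inter> (?A - T) = {}" unfolding D_def by blast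
      ultimately show ?thesis using plus_emeasure[OF D[OF t] diff] by simp
    qed
    ultimately show ?thesis using t unfolding I_def by simp
  qed
  moreover have "disjoint_family_on D I"
    unfolding disjoint_family_on_def
  proof (intro ballI impI, rule ccontr)
    fix t t' assume t: "t \<in> I" "t' \<in> I" "t \<noteq> t'" and "D t \<inter> D t' \<noteq> {}"
    then obtain x where x: "x \<in> translate_set dL \<Gamma> f A t" "x \<in> translate_set dL \<Gamma> f A t'" "x \<in> T"
      unfolding D_def by auto
    have pos: "0 < t" "0 < t'" using t unfolding I_def by auto
    obtain a where a: "a \<in> A" "(a, x) \<in> G" "dL a x = ennreal t" using translate_setE[OF x(1) pos(1)] by blast
    obtain a' where a': "a' \<in> A" "(a', x) \<in> G" "dL a' x = ennreal t'" using translate_setE[OF x(2) pos(2)] by blast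
    have "a = a'" using unique[OF x(3) a(1) a'(1) a(2) a'(2)] .
    then have "ennreal t = ennreal t'" using a(3) a'(3) by simp
    then show False using pos t(3) by simp
  qed
  ultimately have "countable I"
    using D by (intro c.countable_disjoint_positive[of D I]) auto
  then show False using unc by simp
qed

text \<open>Having a successor but not belonging to T, such points have no predecessor. Two of them
  before the same point of T are comparable by linearity, hence equal.\<close>

lemma initial_points_null:
  assumes "A \<in> sets borel" "A \<inter> T = {}" and succ: "\<And>a. a \<in> A \<Longrightarrow> \<exists>y. (a, y) \<in> G \<and> a \<noteq> y"
  shows "emeasure \<mu> A = 0"
proof (rule partial_section_null[OF assms(1)])
  show "A \<subseteq> Teset dL \<Gamma>" using succ unfolding Teset_def by blast
  have no_pred: "b = a" if "a \<in> A" "(b, a) \<in> G" for a b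
    using succ[OF that(1)] assms(2) that unfolding Tset_def by blast
  fix x a a' assume *: "x \<in> T" "a \<in> A" "a' \<in> A" "(a, x) \<in> G" "(a', x) \<in> G"
  show "a = a'"
  proof (cases "dL a x \<le> dL a' x")
    case True
    then show ?thesis using G_backward_linear[OF *(1,4,5)] no_pred[OF *(2)] by metis
  next
    case False
    then show ?thesis using G_backward_linear[OF *(1,5,4)] no_pred[OF *(3)] by simp
  qed
qed

lemma T_subset_Te: "T \<subseteq> Teset dL \<Gamma>"
  unfolding Tset_def Teset_def by blast

text \<open>A moved source has a successor, so outside T it is an initial point. The set of these
  sources need not be Borel, but compact sets of pairs have compact projections, to which
  \<open>initial_points_null\<close> applies.\<close>

lemma moving_points_in_T:
  fixes \<pi> :: "('a \<times> 'a) measure"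
  assumes "finite_measure \<pi>" and sets_\<pi>: "sets \<pi> = sets borel" and marg: "distr \<pi> borel fst = \<mu>"
    and \<Gamma>: "\<Gamma> \<in> sets borel" and conc: "AE p in \<pi>. p \<in> \<Gamma>"
    and S': "S' \<in> sets borel" "S' \<subseteq> T" "T - S' \<in> null_sets (completion \<mu>)"
  shows "AE p in \<pi>. fst p = snd p \<or> p \<in> \<Gamma> \<and> fst p \<noteq> snd p \<and> fst p \<in> S'"
proof -
  have [measurable_cong]: "sets \<pi> = sets (borel \<Otimes>\<^sub>M borel)" using sets_\<pi> unfolding borel_prod .
  have space_\<pi>: "space \<pi> = UNIV" using sets_\<pi> sets_eq_imp_space_eq by fastforce
  have mass: "emeasure \<pi> (fst -` A) = emeasure \<mu> A" if [measurable]: "A \<in> sets borel" for A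
    unfolding marg[symmetric] by (subst emeasure_distr) (auto simp: space_\<pi>)
  \<comment> \<open>Outside \<open>S'\<close> and \<open>Z\<close> a point is outside T; this
    replaces T, measurable only for the completion, by Borel sets.\<close>
  obtain Z where Z: "Z \<in> null_sets \<mu>" "T - S' \<subseteq> Z"
    using S'(3) unfolding null_sets_completion_iff2 by blast
  have [measurable]: "Z \<in> sets borel" "S' \<in> sets borel" using Z(1) S'(1) sets_\<mu> by auto
  have [measurable]: "\<Gamma> \<in> sets (borel \<Otimes>\<^sub>M borel)" using \<Gamma> unfolding borel_prod .
  define D where "D = {p. p \<in> \<Gamma> \<and> fst p \<noteq> snd p \<and> fst p \<notin> S' \<union> Z}"
  have "{p \<in> space (borel \<Otimes>\<^sub>M borel). p \<in> \<Gamma> \<and> fst p \<noteq> snd p \<and> fst p \<notin> S' \<union> Z} \<in> sets (borel \<Otimes>\<^sub>M borel)"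
    by measurable
  then have D: "D \<in> sets borel" unfolding D_def borel_prod by simp
  obtain K :: "nat \<Rightarrow> ('a \<times> 'a) set" where K: "\<And>n. compact (K n)" "(\<Union>n. K n) \<subseteq> D"
    "emeasure \<pi> (D - (\<Union>n. K n)) = 0"
    using inner_compact_exhaustion[OF assms(1) sets_\<pi> D] by blast
  have K_sets: "K n \<in> sets \<pi>" for n using K(1) sets_\<pi> by (simp add: borel_compact)
  have null: "K n \<in> null_sets \<pi>" for n
  proof -
    have fK: "fst ` K n \<in> sets borel"
      using K(1) by (intro borel_compact compact_continuous_image continuous_intros)
    have "emeasure \<mu> (fst ` K n) = 0"
    proof (rule initial_points_null[OF fK])
      show "fst ` K n \<inter> T = {}" using K(2) Z(2) unfolding D_def by force
      fix a assume "a \<in> fst ` K n"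
      then obtain y where "(a, y) \<in> K n" by auto
      then have "(a, y) \<in> \<Gamma>" "a \<noteq> y" using K(2) unfolding D_def by force+
      then show "\<exists>y. (a, y) \<in> G \<and> a \<noteq> y" using \<Gamma>_subset_G by blast
    qed
    moreover have "emeasure \<pi> (K n) \<le> emeasure \<pi> (fst -` (fst ` K n))"
    proof (rule emeasure_mono)
      show "fst -` fst ` K n \<in> sets \<pi>"
        using measurable_sets[of fst \<pi> borel, OF _ fK] by (simp add: space_\<pi>)
    qed auto
    ultimately show ?thesis using mass[OF fK] K_sets by (simp add: null_setsI)
  qed
  have "D - (\<Union>n. K n) \<in> null_sets \<pi>"
    using K(3) D K_sets sets_\<pi> by (intro null_setsI) auto
  then have "AE p in \<pi>. p \<notin> D - (\<Union>n. K n)" by (rule AE_not_in)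
  moreover have "(\<Union>n. K n) \<in> null_sets \<pi>" using null by (rule null_sets_UN)
  then have "AE p in \<pi>. p \<notin> (\<Union>n. K n)" by (rule AE_not_in)
  moreover have "fst -` Z \<in> null_sets \<pi>"
    using mass[of Z] Z(1) measurable_sets[of fst \<pi> borel Z] by (intro null_setsI) (auto simp: space_\<pi>)
  then have "AE p in \<pi>. p \<notin> fst -` Z" by (rule AE_not_in)
  ultimately show ?thesis using conc unfolding D_def by eventually_elim auto
qed

end

section \<open>The transport map\<close>

theorem theorem6p2:
  fixes dL :: "'a::polish_space \<Rightarrow> 'a \<Rightarrow> ennreal"
    and \<mu> \<nu> :: "'a measure"
    and \<pi> :: "('a \<times> 'a) measure"
    and \<Gamma> :: "('a \<times> 'a) set"
    and f :: "'a \<Rightarrow> 'a"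
  assumes std: "standing_assumptions dL"
    and sets_\<mu>: "sets \<mu> = sets borel" and prob_\<mu>: "prob_space \<mu>"
    and sets_\<nu>: "sets \<nu> = sets borel" and prob_\<nu>: "prob_space \<nu>"
    and sets_\<pi>: "sets \<pi> = sets (borel \<Otimes>\<^sub>M borel)"
    and marg1: "distr \<pi> borel fst = \<mu>"
    and marg2: "distr \<pi> borel snd = \<nu>"
    and \<Gamma>_sc: "sigma_compact \<Gamma>"
    and \<Gamma>_cm: "cyclically_monotone dL \<Gamma>"
    and \<Gamma>_fin: "\<Gamma> \<subseteq> {(x, y). dL x y < \<infinity>}"
    and \<pi>_conc: "emeasure \<pi> (UNIV - \<Gamma>) = 0"
    and cost_fin: "(\<integral>\<^sup>+ p. dL (fst p) (snd p) \<partial>\<pi>) < \<infinity>"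
    and f_cs: "cross_section (Rrel dL \<Gamma>) (Tset dL \<Gamma>) f"
    and f_meas: "mu_measurable_on \<mu> (Tset dL \<Gamma>) f"
    and hyp: "\<And>A. A \<in> sets borel \<Longrightarrow> A \<subseteq> Teset dL \<Gamma> \<Longrightarrow> emeasure \<mu> A > 0 \<Longrightarrow>
       uncountable {t::real. t > 0 \<and> emeasure (completion \<mu>) (translate_set dL \<Gamma> f A t) > 0}"
  shows "\<exists>T. T \<in> borel_measurable borel \<and> distr \<mu> borel T = \<nu> \<and>
           (\<integral>\<^sup>+ x. dL x (T x) \<partial>\<mu>) = (\<integral>\<^sup>+ p. dL (fst p) (snd p) \<partial>\<pi>)"
proof -
  let ?T = "Tset dL \<Gamma>" and ?G = "Gset dL \<Gamma>"
  interpret \<mu>: prob_space \<mu> by fact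
  interpret ray_measure dL \<Gamma> f \<mu>
  proof
    show "ext_distance dL" "geodesic_space dL" "non_branching dL"
      using std unfolding standing_assumptions_def by auto
    show "Tset dL \<Gamma> \<in> sets (completion \<mu>)"
      using f_meas[unfolded mu_measurable_on_def, rule_format, of UNIV] by simp
  qed (fact \<Gamma>_cm \<Gamma>_fin f_cs sets_\<mu> hyp)+
  have [measurable_cong]: "sets \<pi> = sets (borel \<Otimes>\<^sub>M borel)" by (fact sets_\<pi>)
  have [measurable_cong]: "sets \<mu> = sets borel" by (fact sets_\<mu>)
  have sets_\<pi>': "sets \<pi> = sets borel" using sets_\<pi> unfolding borel_prod .
  have space_\<pi>: "space \<pi> = UNIV" using sets_\<pi>' sets_eq_imp_space_eq by fastforce
  have prob_\<pi>: "prob_space \<pi>"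
    by (rule prob_space_distrD[of fst \<pi> borel]) (simp_all add: marg1 prob_\<mu>)
  interpret \<pi>: prob_space \<pi> by (rule prob_\<pi>)
  have "(\<lambda>p. dL (fst p) (snd p)) \<in> borel_measurable (borel \<Otimes>\<^sub>M borel)"
    using std unfolding standing_assumptions_def by blast
  from measurable_compose[OF measurable_Pair this]
  have dL_measurable [measurable (raw)]:
    "u \<in> M \<rightarrow>\<^sub>M borel \<Longrightarrow> v \<in> M \<rightarrow>\<^sub>M borel \<Longrightarrow> (\<lambda>w. dL (u w) (v w)) \<in> borel_measurable M"
    for u v and M :: "'c measure"
    by simp

  \<comment> \<open>Borel coordinates for the moved sources\<close>
  obtain K where K: "\<And>n::nat. compact (K n)" "\<Gamma> = (\<Union>n. K n)"
    using \<Gamma>_sc unfolding sigma_compact_def by blast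
  have \<Gamma>_borel: "\<Gamma> \<in> sets borel"
    unfolding K(2) using K(1) by (intro sets.countable_UN) (auto intro: borel_compact)
  then have \<Gamma>_sets [measurable]: "\<Gamma> \<in> sets (borel \<Otimes>\<^sub>M borel)" unfolding borel_prod .
  have conc: "AE p in \<pi>. p \<in> \<Gamma>"
    by (rule AE_I[OF _ \<pi>_conc]) (auto simp: sets_\<pi>' intro: borel_comp[OF \<Gamma>_borel, unfolded Compl_eq_Diff_UNIV])

  obtain S' f' where S' [measurable]: "S' \<in> sets borel" and S'_T: "S' \<subseteq> ?T"
    and S'_null: "?T - S' \<in> null_sets (completion \<mu>)"
    and f' [measurable]: "f' \<in> borel_measurable borel" and f'_eq: "\<And>x. x \<in> S' \<Longrightarrow> f' x = f x"
    using borel_version_on[OF sets_\<mu> f_meas] by blast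
  define D1 where "D1 = {p. p \<in> \<Gamma> \<and> fst p \<noteq> snd p \<and> fst p \<in> S'}"
  have AE_D1: "AE p in \<pi>. fst p = snd p \<or> p \<in> D1"
    using moving_points_in_T[OF \<pi>.finite_measure_axioms sets_\<pi>' marg1 \<Gamma>_borel conc S' S'_T S'_null]
    unfolding D1_def by simp
  have "{p \<in> space (borel \<Otimes>\<^sub>M borel). p \<in> \<Gamma> \<and> fst p \<noteq> snd p \<and> fst p \<in> S'} \<in> sets (borel \<Otimes>\<^sub>M borel)"
    by measurable
  then have D1: "D1 \<in> sets borel" unfolding D1_def borel_prod by simp

  \<comment> \<open>The formula of \<open>pos_eq_distances\<close> with the Borel version
    \<open>f'\<close> of the section. It is Borel but a function of the pair; on \<open>D1\<close>
    it depends on the source alone, and \<open>factor_through\<close> makes it a Borel function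
    \<open>h\<close> of the source.\<close>
  define v where "v p = (if dL (f' (fst p)) (snd p) = dL (f' (fst p)) (fst p) + dL (fst p) (snd p)
    then enn2real (dL (f' (fst p)) (fst p)) else - enn2real (dL (f' (fst p)) (fst p)))" for p
  have "v \<in> borel_measurable (borel \<Otimes>\<^sub>M borel)" unfolding v_def by measurable
  then have v: "v \<in> borel_measurable borel" unfolding borel_prod .
  have fst_borel: "(fst :: 'a \<times> 'a \<Rightarrow> 'a) \<in> borel_measurable borel"
    unfolding borel_prod[symmetric] by measurable
  have v_pos: "v p = pos (fst p)" if "p \<in> D1" for p
  proof -
    have "(fst p, snd p) \<in> ?G" "fst p \<noteq> snd p" "fst p \<in> ?T" "f' (fst p) = f (fst p)"
      using that \<Gamma>_subset_G S'_T f'_eq unfolding D1_def by auto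
    then show ?thesis using pos_eq_distances[of "fst p" "snd p"] unfolding v_def by simp
  qed
  have v_det: "v p = v p'" if "p \<in> D1" "p' \<in> D1" "fst p = fst p'" for p p'
    using that v_pos by simp
  obtain D2 h where D2: "D2 \<in> sets borel" "D2 \<subseteq> D1" "emeasure \<pi> (D1 - D2) = 0"
    and X_sets: "fst ` D2 \<in> sets borel" and h [measurable]: "h \<in> borel_measurable borel"
    and h_v: "\<And>p. p \<in> D2 \<Longrightarrow> h (fst p) = v p"
    using factor_through[OF \<pi>.finite_measure_axioms sets_\<pi>' fst_borel v D1 v_det] by blast
  define X where "X = fst ` D2"
  have X [measurable]: "X \<in> sets borel" unfolding X_def by (rule X_sets)
  have X_S': "X \<subseteq> S'" and X_T: "X \<subseteq> ?T" using D2(2) S'_T unfolding X_def D1_def by auto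
  have h_pos: "h x = pos x" if "x \<in> X" for x
    using that h_v v_pos D2(2) unfolding X_def by fastforce
  have AE_X: "AE p in \<pi>. fst p \<notin> X \<longrightarrow> snd p = fst p"
  proof -
    have "D1 - D2 \<in> null_sets \<pi>" using D1 D2(1,3) sets_\<pi>' by (intro null_setsI) auto
    then have "AE p in \<pi>. p \<notin> D1 - D2" by (rule AE_not_in)
    with AE_D1 show ?thesis by eventually_elim (auto simp: X_def)
  qed

  \<comment> \<open>The plan above \<open>X\<close> and the absence of atoms\<close>
  define XX where "XX = X \<times> (UNIV :: 'a set)"
  have XX [measurable]: "XX \<in> sets (borel \<Otimes>\<^sub>M borel)" unfolding XX_def by measurable
  \<comment> \<open>Every pair above \<open>X\<close> is kept, including unmoved ones: a source may
    be split between moving and staying, and for the latter \<open>E = S\<close>.\<close>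
  define N where "N = density \<pi> (indicator XX)"
  have sets_N [measurable_cong]: "sets N = sets (borel \<Otimes>\<^sub>M borel)" unfolding N_def by (simp add: sets_\<pi>)
  have sets_N': "sets N = sets borel" using sets_N unfolding borel_prod .
  have space_N: "space N = UNIV" unfolding N_def by (simp add: space_\<pi>)
  have N: "emeasure N A = emeasure \<pi> (XX \<inter> A)" if "A \<in> sets (borel \<Otimes>\<^sub>M borel)" for A
    unfolding N_def using that by (intro emeasure_restricted) (simp_all add: sets_\<pi> XX)
  have fin_N: "finite_measure N"
  proof (rule finite_measureI)
    have "UNIV \<in> sets (borel \<Otimes>\<^sub>M borel :: ('a \<times> 'a) measure)" unfolding borel_prod by simp
    then show "emeasure N (space N) \<noteq> \<infinity>" unfolding space_N by (simp only: N) (simp add: \<pi>.emeasure_finite)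
  qed
  have AE_N: "AE p in N. P p" if "AE p in \<pi>. p \<in> XX \<longrightarrow> P p" for P
    using that unfolding N_def by (subst AE_density) (auto simp: indicator_def split: if_splits)
  have N_X: "AE p in N. fst p \<in> X" by (rule AE_N) (simp add: XX_def mem_Times_iff)
  have N_\<Gamma>: "AE p in N. p \<in> \<Gamma>" by (rule AE_N) (use conc in auto)

  define q where "q p = f' (fst p)" for p :: "'a \<times> 'a"
  define S where "S p = h (fst p)" for p :: "'a \<times> 'a"
  define E where "E p = S p + enn2real (dL (fst p) (snd p))" for p
  have q [measurable]: "q \<in> borel_measurable N" and S [measurable]: "S \<in> borel_measurable N"
    unfolding q_def S_def by measurable
  have E [measurable]: "E \<in> borel_measurable N" unfolding E_def by measurable
  interpret N: diffuse_fibred_variable N q S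
  proof (intro diffuse_fibred_variable.intro fibred_variable.intro fibred_variable_axioms.intro
      diffuse_fibred_variable_axioms.intro)
    fix \<sigma> :: "'a \<Rightarrow> ereal" assume [measurable]: "\<sigma> \<in> borel_measurable borel"
    \<comment> \<open>Position is here a prescribed function of the ray, so two points of
      \<open>A\<close> on one ray have equal positions and coincide.\<close>
    define A where "A = {x. x \<in> X \<and> ereal (h x) = \<sigma> (f' x)}"
    have "{x \<in> space borel. x \<in> X \<and> ereal (h x) = \<sigma> (f' x)} \<in> sets borel" by measurable
    then have A [measurable]: "A \<in> sets borel" unfolding A_def by simp
    have "emeasure \<mu> A = 0"
    proof (rule partial_section_null[OF A])
      show "A \<subseteq> Teset dL \<Gamma>" using X_T T_subset_Te unfolding A_def by blast
      fix x a a' assume *: "x \<in> ?T" "a \<in> A" "a' \<in> A" "(a, x) \<in> ?G" "(a', x) \<in> ?G"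
      have aX: "a \<in> X" "a' \<in> X" and eq: "ereal (h a) = \<sigma> (f' a)" "ereal (h a') = \<sigma> (f' a')"
        using *(2,3) unfolding A_def by auto
      have aT: "a \<in> ?T" "a' \<in> ?T" using aX X_T by auto
      have ff: "f a = f a'" using section_eq[OF aT(1) *(1,4)] section_eq[OF aT(2) *(1,5)] by simp
      then have "f' a = f' a'" using aX X_S' f'_eq by (metis subsetD)
      then have "ereal (h a) = ereal (h a')" using eq by simp
      then have "h a = h a'" by simp
      then show "a = a'" using pos_inj[OF aT ff] h_pos aX by simp
    qed
    moreover have "emeasure N {p \<in> space N. ereal (S p) = \<sigma> (q p)} = emeasure \<pi> (fst -` A)"
    proof -
      have "{p \<in> space N. ereal (S p) = \<sigma> (q p)} \<in> sets N" by measurable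
      moreover have "XX \<inter> {p \<in> space N. ereal (S p) = \<sigma> (q p)} = fst -` A"
        unfolding XX_def A_def S_def q_def space_N by auto
      ultimately show ?thesis using N[of "{p \<in> space N. ereal (S p) = \<sigma> (q p)}"] by (simp add: sets_N)
    qed
    moreover have "emeasure \<pi> (fst -` A) = emeasure \<mu> A"
      unfolding marg1[symmetric] by (subst emeasure_distr) (auto simp: space_\<pi>)
    ultimately show "emeasure N {p \<in> space N. ereal (S p) = \<sigma> (q p)} = 0" by simp
  qed (fact fin_N q S)+
  have S_le_E: "S p \<le> E p" for p unfolding E_def by simp
  obtain \<tau> where \<tau> [measurable]: "\<tau> \<in> borel_measurable (borel \<Otimes>\<^sub>M borel)" and \<tau>_ge: "\<And>x s. s \<le> \<tau> (x, s)"
    and \<tau>_law: "distr N (borel \<Otimes>\<^sub>M borel) (\<lambda>p. (q p, \<tau> (q p, S p))) = distr N (borel \<Otimes>\<^sub>M borel) (\<lambda>p. (q p, E p))"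
    using N.fibrewise_rearrangement[OF E S_le_E] by blast

  \<comment> \<open>Targets as functions of ray and position\<close>
  define D3 where "D3 = {p. p \<in> \<Gamma> \<and> fst p \<in> X}"
  have "{p \<in> space (borel \<Otimes>\<^sub>M borel). p \<in> \<Gamma> \<and> fst p \<in> X} \<in> sets (borel \<Otimes>\<^sub>M borel)" by measurable
  then have D3: "D3 \<in> sets borel" unfolding D3_def borel_prod by simp
  have D3_ray: "fst p \<in> ?T" "(fst p, snd p) \<in> ?G" "q p = f (fst p)" "S p = pos (fst p)"
    "dL (fst p) (snd p) = ennreal (E p - pos (fst p))" "pos (fst p) \<le> E p" if "p \<in> D3" for p
  proof -
    have p: "p \<in> \<Gamma>" "fst p \<in> X" using that unfolding D3_def by auto
    show "fst p \<in> ?T" "(fst p, snd p) \<in> ?G" "q p = f (fst p)" and Sp: "S p = pos (fst p)"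
      using p X_T X_S' \<Gamma>_subset_G f'_eq h_pos unfolding q_def S_def by auto
    have "dL (fst p) (snd p) < \<infinity>" using p(1) \<Gamma>_fin by (cases p) auto
    then show "dL (fst p) (snd p) = ennreal (E p - pos (fst p))" "pos (fst p) \<le> E p"
      unfolding E_def Sp by (simp_all add: less_top[symmetric])
  qed
  define u where "u p = (q p, E p)" for p
  have u_sets [measurable]: "u \<in> N \<rightarrow>\<^sub>M borel \<Otimes>\<^sub>M borel" unfolding u_def by measurable
  have u: "u \<in> borel_measurable borel"
    using u_sets unfolding borel_prod measurable_cong_sets[OF sets_N' refl] .
  have snd_borel: "(snd :: 'a \<times> 'a \<Rightarrow> 'a) \<in> borel_measurable borel"
    unfolding borel_prod[symmetric] by measurable
  have det: "snd p = snd p'" if "p \<in> D3" "p' \<in> D3" "u p = u p'" for p p'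
  proof -
    note r = D3_ray[OF that(1)] and r' = D3_ray[OF that(2)]
    have "f (fst p) = f (fst p')" "E p' = E p" using that(3) r(3) r'(3) unfolding u_def by auto
    then show ?thesis
      using ray_end_unique[OF r(1) r'(1) _ r(2) r'(2) r(5,6)] r'(5,6) by simp
  qed
  \<comment> \<open>\<open>g\<close> returns a target from its coordinates. The image of
    \<open>D4\<close> under \<open>u\<close> is the set of occupied coordinates; since it is Borel,
    its mass can be compared under two laws.\<close>
  obtain D4 g where D4: "D4 \<in> sets borel" "D4 \<subseteq> D3" "emeasure N (D3 - D4) = 0"
    and uD4: "u ` D4 \<in> sets borel" and g_borel: "g \<in> borel_measurable borel"
    and g_eq: "\<And>p. p \<in> D4 \<Longrightarrow> g (u p) = snd p"
    using factor_through[OF fin_N sets_N' u snd_borel D3 det] by blast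
  have g [measurable]: "g \<in> borel_measurable (borel \<Otimes>\<^sub>M borel)" using g_borel unfolding borel_prod .
  have uD4' [measurable]: "u ` D4 \<in> sets (borel \<Otimes>\<^sub>M borel)" using uD4 unfolding borel_prod .
  have AE_D4: "AE p in N. p \<in> D4"
  proof -
    have "D3 - D4 \<in> null_sets N" using D3 D4 sets_N' by (intro null_setsI) auto
    then have "AE p in N. p \<notin> D3 - D4" by (rule AE_not_in)
    with N_X N_\<Gamma> show ?thesis by eventually_elim (auto simp: D3_def)
  qed

  \<comment> \<open>The map and its displacement\<close>
  define T0 where "T0 x = (if x \<in> X then g (f' x, \<tau> (f' x, h x)) else x)" for x
  have T0 [measurable]: "T0 \<in> borel_measurable borel" unfolding T0_def by measurable
  have T0_N: "AE p in N. T0 (fst p) = g (q p, \<tau> (q p, S p))"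
    using N_X by eventually_elim (simp add: T0_def q_def S_def)
  have AE_law: "(AE z in distr N (borel \<Otimes>\<^sub>M borel) (\<lambda>p. (q p, w p)). z \<in> u ` D4) \<longleftrightarrow>
      (AE p in N. (q p, w p) \<in> u ` D4)" if [measurable]: "w \<in> borel_measurable N" for w
    by (rule AE_distr_iff) measurable
  have \<tau>S: "(\<lambda>p. \<tau> (q p, S p)) \<in> borel_measurable N" by measurable
  have "AE p in N. (q p, E p) \<in> u ` D4"
    using AE_D4 by eventually_elim (auto simp: u_def)
  \<comment> \<open>Equal laws charge the same Borel sets, so position \<tau> on the ray of the
    source is almost surely that of a target of the plan.\<close>
  then have AE_\<tau>: "AE p in N. (q p, \<tau> (q p, S p)) \<in> u ` D4"
    unfolding AE_law[OF E, symmetric] AE_law[OF \<tau>S, symmetric] \<tau>_law .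
  have dist_T0: "AE p in N. dL (fst p) (T0 (fst p)) = ennreal (\<tau> (q p, S p) - S p)"
    using AE_\<tau> N_X T0_N
  proof eventually_elim
    case (elim p)
    \<comment> \<open>\<open>p'\<close> is a pair of the plan on the same ray, possibly with a
      different source; \<open>ray_distance\<close> transfers its target to the source of
      \<open>p\<close>.\<close>
    then obtain p' where p': "p' \<in> D4" "q p = q p'" "\<tau> (q p, S p) = E p'" unfolding u_def by auto
    note r' = D3_ray[OF subsetD[OF D4(2) p'(1)]]
    have p: "fst p \<in> ?T" "q p = f (fst p)" "S p = pos (fst p)"
      using elim(2) X_T X_S' f'_eq h_pos unfolding q_def S_def by auto
    have "T0 (fst p) = snd p'" using elim(3) g_eq[OF p'(1)] p'(2,3) unfolding u_def by simp
    moreover have "pos (fst p) \<le> E p'" using \<tau>_ge[of "S p" "q p"] p'(3) p(3) by simp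
    ultimately show ?case
      using ray_distance(2)[OF p(1) r'(1) _ r'(2,5,6)] p p' r'(3) by simp
  qed

  \<comment> \<open>The image measure\<close>
  have push: "distr \<mu> borel T0 = \<nu>"
  proof (rule measure_eqI)
    show "sets (distr \<mu> borel T0) = sets \<nu>" using sets_\<nu> by simp
    fix C assume "C \<in> sets (distr \<mu> borel T0)"
    then have C [measurable]: "C \<in> sets borel" by simp
    have split: "emeasure \<pi> {p. P p} = emeasure N {p. P p} + emeasure \<pi> {p. fst p \<notin> X \<and> P p}"
      if P: "{p. P p} \<in> sets (borel \<Otimes>\<^sub>M borel)" for P
    proof -
      have "{p. fst p \<notin> X \<and> P p} = {p. P p} - XX" unfolding XX_def by auto
      then have "{p. fst p \<notin> X \<and> P p} \<in> sets \<pi>" "XX \<inter> {p. P p} \<in> sets \<pi>" using P XX sets_\<pi> by auto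
      moreover have "{p. P p} = (XX \<inter> {p. P p}) \<union> {p. fst p \<notin> X \<and> P p}"
        "(XX \<inter> {p. P p}) \<inter> {p. fst p \<notin> X \<and> P p} = {}" unfolding XX_def by auto
      ultimately show ?thesis using N[OF P] plus_emeasure by metis
    qed
    have sp: "{p. P p} \<in> sets (borel \<Otimes>\<^sub>M borel)"
      if "Measurable.pred (borel \<Otimes>\<^sub>M borel) P" for P :: "'a \<times> 'a \<Rightarrow> bool"
      using predE[OF that] by (simp add: space_pair_measure)
    have m1: "{p :: 'a \<times> 'a. T0 (fst p) \<in> C} \<in> sets (borel \<Otimes>\<^sub>M borel)" by (rule sp) measurable
    have m2: "{p :: 'a \<times> 'a. snd p \<in> C} \<in> sets (borel \<Otimes>\<^sub>M borel)" by (rule sp) measurable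
    have "emeasure (distr \<mu> borel T0) C = emeasure \<pi> {p. T0 (fst p) \<in> C}"
      unfolding marg1[symmetric]
      by (subst distr_distr) (auto simp: emeasure_distr space_\<pi> vimage_def)
    also have "\<dots> = emeasure N {p. T0 (fst p) \<in> C} + emeasure \<pi> {p. fst p \<notin> X \<and> T0 (fst p) \<in> C}"
      by (rule split[OF m1])
    \<comment> \<open>Outside \<open>X\<close> the map and, almost surely, the plan both leave the
      source in place.\<close>
    also have "emeasure \<pi> {p. fst p \<notin> X \<and> T0 (fst p) \<in> C} = emeasure \<pi> {p. fst p \<notin> X \<and> snd p \<in> C}"
    proof (rule emeasure_eq_AE)
      show "AE p in \<pi>. p \<in> {p. fst p \<notin> X \<and> T0 (fst p) \<in> C} \<longleftrightarrow> p \<in> {p. fst p \<notin> X \<and> snd p \<in> C}"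
        using AE_X by eventually_elim (auto simp: T0_def)
      show "{p. fst p \<notin> X \<and> T0 (fst p) \<in> C} \<in> sets \<pi>" "{p. fst p \<notin> X \<and> snd p \<in> C} \<in> sets \<pi>"
        unfolding sets_\<pi> by (rule sp, measurable)+
    qed
    also have "emeasure N {p. T0 (fst p) \<in> C} = emeasure N {p. snd p \<in> C}"
    proof -
      have law: "emeasure N {p. g (q p, w p) \<in> C} = emeasure (distr N (borel \<Otimes>\<^sub>M borel) (\<lambda>p. (q p, w p))) (g -` C)"
        if [measurable]: "w \<in> borel_measurable N" for w
      proof -
        have "g -` C \<in> sets (borel \<Otimes>\<^sub>M borel)" using measurable_sets[OF g C] by (simp add: space_pair_measure)
        then show ?thesis by (subst emeasure_distr) (auto simp: space_N vimage_def)
      qed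
      have Nsets: "{p. P p} \<in> sets N" if "Measurable.pred N P" for P
        using predE[OF that] by (simp add: space_N)
      have "emeasure N {p. T0 (fst p) \<in> C} = emeasure N {p. g (q p, \<tau> (q p, S p)) \<in> C}"
      proof (rule emeasure_eq_AE)
        show "AE p in N. p \<in> {p. T0 (fst p) \<in> C} \<longleftrightarrow> p \<in> {p. g (q p, \<tau> (q p, S p)) \<in> C}"
          using T0_N by eventually_elim simp
        show "{p. T0 (fst p) \<in> C} \<in> sets N" by (rule Nsets) measurable
        show "{p. g (q p, \<tau> (q p, S p)) \<in> C} \<in> sets N" by (rule Nsets) measurable
      qed
      also have "\<dots> = emeasure N {p. g (q p, E p) \<in> C}"
        using law[of "\<lambda>p. \<tau> (q p, S p)"] law[of E] \<tau>_law by simp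
      also have "\<dots> = emeasure N {p. snd p \<in> C}"
      proof (rule emeasure_eq_AE)
        show "AE p in N. p \<in> {p. g (q p, E p) \<in> C} \<longleftrightarrow> p \<in> {p. snd p \<in> C}"
          using AE_D4 by eventually_elim (use g_eq in \<open>simp add: u_def\<close>)
        show "{p. g (q p, E p) \<in> C} \<in> sets N" by (rule Nsets) measurable
        show "{p. snd p \<in> C} \<in> sets N" by (rule Nsets) measurable
      qed
      finally show ?thesis .
    qed
    also have "emeasure N {p. snd p \<in> C} + emeasure \<pi> {p. fst p \<notin> X \<and> snd p \<in> C} = emeasure \<pi> {p. snd p \<in> C}"
      by (rule split[OF m2, symmetric])
    also have "\<dots> = emeasure \<nu> C"
      unfolding marg2[symmetric] by (subst emeasure_distr) (auto simp: space_\<pi> vimage_def)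
    finally show "emeasure (distr \<mu> borel T0) C = emeasure \<nu> C" .
  qed

  \<comment> \<open>Equality of the costs\<close>
  have on_X: "(\<integral>\<^sup>+p. F p \<partial>\<pi>) = (\<integral>\<^sup>+p. F p \<partial>N)"
    if F [measurable]: "F \<in> borel_measurable (borel \<Otimes>\<^sub>M borel)" and "AE p in \<pi>. fst p \<notin> X \<longrightarrow> F p = 0" for F
  proof -
    have "(\<integral>\<^sup>+p. F p \<partial>\<pi>) = (\<integral>\<^sup>+p. indicator XX p * F p \<partial>\<pi>)"
      using that(2) by (intro nn_integral_cong_AE) (auto simp: XX_def mem_Times_iff split: split_indicator)
    also have "\<dots> = (\<integral>\<^sup>+p. F p \<partial>N)" unfolding N_def by (subst nn_integral_density) auto
    finally show ?thesis .
  qed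
  have "(\<integral>\<^sup>+x. dL x (T0 x) \<partial>\<mu>) = (\<integral>\<^sup>+p. dL (fst p) (T0 (fst p)) \<partial>\<pi>)"
    unfolding marg1[symmetric] by (subst nn_integral_distr) auto
  also have "\<dots> = (\<integral>\<^sup>+p. dL (fst p) (T0 (fst p)) \<partial>N)"
    by (rule on_X) (auto simp: T0_def)
  also have "\<dots> = (\<integral>\<^sup>+p. ennreal (\<tau> (q p, S p) - S p) \<partial>N)"
    using dist_T0 by (rule nn_integral_cong_AE)
  \<comment> \<open>\<open>S\<close> is common to both integrals, and equality of the joint laws
    makes the laws of \<tau> and \<open>E\<close> agree.\<close>
  also have "\<dots> = (\<integral>\<^sup>+p. ennreal (E p - S p) \<partial>N)"
  proof (rule nn_integral_diff_cong_distr[OF fin_N S _ E \<tau>_ge S_le_E])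
    have "distr (distr N (borel \<Otimes>\<^sub>M borel) (\<lambda>p. (q p, w p))) borel snd = distr N borel w"
      if "w \<in> borel_measurable N" for w :: "'a \<times> 'a \<Rightarrow> real"
      using that by (subst distr_distr) (auto simp: comp_def)
    from this[of "\<lambda>p. \<tau> (q p, S p)"] this[of E]
    show "distr N borel (\<lambda>p. \<tau> (q p, S p)) = distr N borel E" using \<tau>_law by simp
  qed measurable
  also have "\<dots> = (\<integral>\<^sup>+p. dL (fst p) (snd p) \<partial>N)"
    using AE_D4 by (intro nn_integral_cong_AE, eventually_elim) (use D3_ray D4(2) in auto)
  also have "\<dots> = (\<integral>\<^sup>+p. dL (fst p) (snd p) \<partial>\<pi>)"
    using AE_X by (intro on_X[symmetric]) auto
  finally show ?thesis using T0 push by blast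
qed

end
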